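(* Let $r,k$ be positive integers, let $M$ be an invertible real $(r+k)\times(r+k)$ matrix, and let $\mathbf w\in\mathbb R^{r+k}$ be sufficiently generic. For $S\subseteq\mathbb R^{r+k}$ let $\mathbf 1_S$ denote its indicator function. The function $f:\mathbb R^{r+k}\to\mathbb Z$ defined by $$f(\mathbf p):=\Big(\sum_{T\in\mathbf T^+(M)}\mathbf 1_T(\mathbf p)\Big)-\Big(\sum_{T\in\mathbf T^-(M)}\mathbf 1_T(\mathbf p)\Big)$$ is constant with value $(-1)^k\,\mathrm{sgn}(\det(M))$.
   Context: $[n]=\{1,\dots,n\}$ and $\binom{[n]}{m}$ is the set of $m$-element subsets of $[n]$. For $x\neq 0$, $\mathrm{sgn}(x)=1$ if $x>0$ and $-1$ if $x<0$. For a matrix $N$, $N_i$ is its $i$-th column. For $i\in[r+k]$, $\mathbf c_i\in\mathbb R^r$ is the vector of the first $r$ entries of $M_i$, and $\overline{\mathbf c}_i\in\mathbb R^k$ is the negative of the vector of the last $k$ entries of $M_i$. For $\sigma\in\binom{[r+k]}{r}$, the fragment matrix $S_\sigma(M)$ is the $(r+k)\times(r+k)$ matrix whose $i$-th column is $\begin{bmatrix}\mathbf c_i\\ \mathbf 0\end{bmatrix}$ if $i\in\sigma$ and $\begin{bmatrix}\mathbf 0\\ \overline{\mathbf c}_i\end{bmatrix}$ if $i\notin\sigma$. Sufficiently generic: $\mathbf w$ is not in the span of any $r+k-1$ of the columns of $M$, nor of any $r+k-1$ of the columns of any $S_\sigma(M)$; moreover the vector $\mathbf w'$ of the first $r$ entries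 of $\mathbf w$ is not in the span of any $r-1$ of the $\mathbf c_i$, and the vector $\mathbf w''$ of the last $k$ entries of $\mathbf w$ is not in the span of any $k-1$ of the $\overline{\mathbf c}_i$. For an $(r+k)\times(r+k)$ matrix $N$, the half-open parallelepiped $\Pi(N)$ is the set of $\mathbf p\in\mathbb R^{r+k}$ such that for all sufficiently small $\epsilon>0$ the point $\mathbf p+\epsilon\mathbf w$ lies in $\{\sum_i x_iN_i: 0\le x_i\le 1\}$. For $\mathbf z\in\mathbb Z^{r+k}$ and $\sigma\in\binom{[r+k]}{r}$, the tile is $\mathcal T(\mathbf z,\sigma):=\Pi(S_\sigma(M))+M\mathbf z$. $\mathbf T^+(M)$ (resp. $\mathbf T^-(M)$) is the family of all tiles $\mathcal T(\mathbf z,\sigma)$, indexed by pairs $(\mathbf z,\sigma)$ with $\det(S_\sigma(M))>0$ (resp. $<0$); tiles with different indices count as different members. *)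

theory Defs
  imports "HOL-Analysis.Analysis"
begin

text \<open>
  The index set \<open>[r + k]\<close>, for rows as well as for columns, is the type \<open>'r + 'k\<close> with
  \<open>r = CARD('r)\<close> and \<open>k = CARD('k)\<close>: the \<open>Inl\<close> indices are the first \<open>r\<close> ones and the \<open>Inr\<close>
  indices the last \<open>k\<close> ones. Since rows and columns share one index type, the determinant does
  not depend on how this type is enumerated.
\<close>

definition first_part :: "real ^ ('r::finite + 'k::finite) \<Rightarrow> real ^ 'r" where
  "first_part v = (\<chi> i. v $ Inl i)"

definition last_part :: "real ^ ('r::finite + 'k::finite) \<Rightarrow> real ^ 'k" where
  "last_part v = (\<chi> i. v $ Inr i)"

definition stack :: "real ^ 'r::finite \<Rightarrow> real ^ 'k::finite \<Rightarrow> real ^ ('r + 'k)" where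
  "stack a b = (\<chi> i. case i of Inl s \<Rightarrow> a $ s | Inr t \<Rightarrow> b $ t)"

definition cvec ::
  "real ^ ('r::finite + 'k::finite) ^ ('r + 'k) \<Rightarrow> 'r + 'k \<Rightarrow> real ^ 'r" where
  "cvec M i = first_part (column i M)"

definition cbar ::
  "real ^ ('r::finite + 'k::finite) ^ ('r + 'k) \<Rightarrow> 'r + 'k \<Rightarrow> real ^ 'k" where
  "cbar M i = - last_part (column i M)"

definition fragment ::
  "('r + 'k) set \<Rightarrow> real ^ ('r::finite + 'k::finite) ^ ('r + 'k) \<Rightarrow> real ^ ('r + 'k) ^ ('r + 'k)"
  where
  "fragment \<sigma> M = (\<chi> a i. (if i \<in> \<sigma> then stack (cvec M i) 0 else stack 0 (cbar M i)) $ a)"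

text \<open>
  ``Any \<open>m\<close> of the columns'' refers to \<open>m\<close> distinct column indices; the columns themselves
  may coincide.
\<close>

definition sufficiently_generic ::
  "real ^ ('r::finite + 'k::finite) ^ ('r + 'k) \<Rightarrow> real ^ ('r + 'k) \<Rightarrow> bool" where
  "sufficiently_generic M w \<longleftrightarrow>
     (\<forall>J. card J = CARD('r) + CARD('k) - 1 \<longrightarrow> w \<notin> span ((\<lambda>i. column i M) ` J)) \<and>
     (\<forall>\<sigma> J. card \<sigma> = CARD('r) \<longrightarrow> card J = CARD('r) + CARD('k) - 1 \<longrightarrow>
        w \<notin> span ((\<lambda>i. column i (fragment \<sigma> M)) ` J)) \<and>
     (\<forall>J. card J = CARD('r) - 1 \<longrightarrow> first_part w \<notin> span (cvec M ` J)) \<and>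
     (\<forall>J. card J = CARD('k) - 1 \<longrightarrow> last_part w \<notin> span (cbar M ` J))"

definition closed_parallelepiped :: "real ^ 'n::finite ^ 'n \<Rightarrow> (real ^ 'n) set" where
  "closed_parallelepiped N =
     {(\<Sum>i\<in>UNIV. x i *\<^sub>R column i N) | x. \<forall>i. 0 \<le> x i \<and> x i \<le> (1::real)}"

definition half_open_parallelepiped ::
  "real ^ 'n::finite \<Rightarrow> real ^ 'n ^ 'n \<Rightarrow> (real ^ 'n) set" where
  "half_open_parallelepiped w N =
     {p. \<forall>\<^sub>F \<epsilon> in at_right (0::real). p + \<epsilon> *\<^sub>R w \<in> closed_parallelepiped N}"

definition tile ::
  "real ^ ('r::finite + 'k::finite) \<Rightarrow> real ^ ('r + 'k) ^ ('r + 'k) \<Rightarrow>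
   (int ^ ('r + 'k)) \<times> ('r + 'k) set \<Rightarrow> (real ^ ('r + 'k)) set" where
  "tile w M = (\<lambda>(z, \<sigma>).
     (\<lambda>p. p + M *v (\<chi> i. real_of_int (z $ i))) ` half_open_parallelepiped w (fragment \<sigma> M))"

text \<open>
  The families of positive and negative tiles are represented by their index sets, so that tiles
  with different indices count separately even if they coincide as sets.
\<close>

definition pos_tiles ::
  "real ^ ('r::finite + 'k::finite) ^ ('r + 'k) \<Rightarrow> ((int ^ ('r + 'k)) \<times> ('r + 'k) set) set" where
  "pos_tiles M = {(z, \<sigma>). card \<sigma> = CARD('r) \<and> det (fragment \<sigma> M) > 0}"

definition neg_tiles ::
  "real ^ ('r::finite + 'k::finite) ^ ('r + 'k) \<Rightarrow> ((int ^ ('r + 'k)) \<times> ('r + 'k) set) set" where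
  "neg_tiles M = {(z, \<sigma>). card \<sigma> = CARD('r) \<and> det (fragment \<sigma> M) < 0}"

text \<open>
  The sums range over infinite index sets; \<^const>\<open>infsum\<close> on the discrete type \<^typ>\<open>int\<close>
  is the sum over the indices with nonzero term when there are finitely many of them, and is the
  junk value 0 otherwise. A statement about \<open>signed_count\<close> should therefore be accompanied by
  the finiteness of the set of tiles containing a point.
\<close>

definition signed_count ::
  "real ^ ('r::finite + 'k::finite) \<Rightarrow> real ^ ('r + 'k) ^ ('r + 'k) \<Rightarrow> real ^ ('r + 'k) \<Rightarrow> int" where
  "signed_count w M p =
     (\<Sum>\<^sub>\<infinity>t\<in>pos_tiles M. indicator (tile w M t) p) -
     (\<Sum>\<^sub>\<infinity>t\<in>neg_tiles M. indicator (tile w M t) p)"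

end

theory Submission imports Defs begin

text \<open>
  The proof computes a Fourier series. In the coordinates \<open>y = M\<^sup>-\<^sup>1 p\<close> the signed count is
  invariant under integer translations, and its integral against a periodic function \<open>f\<close> unfolds to
  \<open>\<Sum>\<sigma>. det (fragment \<sigma> M) * (\<integral>x\<in>[0,1]\<^sup>n. f (M\<^sup>-\<^sup>1 (fragment \<sigma> M *v x)))\<close>, up to the factor
  \<open>\<bar>det M\<bar>\<close>. For a wave \<open>f y = exp (2 \<pi> \<i> (m \<bullet> y))\<close> of integer frequency \<open>m\<close> every integral
  is a product of one-dimensional integrals, one for each column of the fragment, and by Laplace
  expansion (\<open>sum_det_fragment\<close>) the sum over \<open>\<sigma>\<close> is a single determinant. Its rows are linearly
  dependent if \<open>m \<noteq> 0\<close>, and it equals \<open>(-1)\<^sup>k det M\<close> if \<open>m = 0\<close> (\<open>fragment_wave_identity\<close>).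
  So all nonconstant Fourier coefficients vanish, and the constant one is as claimed.

  To get from Fourier coefficients to values, the identity is extended to all continuous periodic
  functions by the Stone--Weierstrass theorem (\<open>fragment_defect_torus\<close>) and applied to a bump. For
  generic \<open>w\<close> and small \<open>\<epsilon> > 0\<close>, the point \<open>p + \<epsilon> w\<close> lies off the walls of all nondegenerate tiles, and it
  lies in exactly those closed tiles whose half-open versions contain \<open>p\<close>
  (\<open>eventually_inside_or_outside\<close>). A bump supported near this point and its translates meets
  each tile in full copies or not at all, so its integral over a tile counts translates of
  that tile containing \<open>p\<close> (\<open>integral_matrix_periodic_bump\<close>). Degenerate fragments, with
  determinant zero, drop out on both sides.
\<close>

section \<open>Linear change of variables\<close>

lemma measure_permuted_cbox:
  fixes a b :: "real ^ 'n"
  assumes p: "p permutes (UNIV :: 'n::finite set)"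
  shows "measure lebesgue ((\<lambda>x. \<chi> i. x $ p i) ` cbox a b) = measure lebesgue (cbox a b)"
proof -
  have eq: "(\<lambda>x. \<chi> i. x $ p i) ` cbox a b = cbox (\<chi> i. a $ p i) (\<chi> i. b $ p i)"
  proof (intro set_eqI iffI)
    fix y assume "y \<in> cbox (\<chi> i. a $ p i) (\<chi> i. b $ p i)"
    then have "a $ p i \<le> y $ i" "y $ i \<le> b $ p i" for i
      by (auto simp: mem_box_cart)
    from this[of "inv p _"] have "(\<chi> i. y $ inv p i) \<in> cbox a b"
      by (simp add: mem_box_cart permutes_inverses(1)[OF p])
    moreover have "y = (\<lambda>x. \<chi> i. x $ p i) (\<chi> i. y $ inv p i)"
      by (simp add: vec_eq_iff permutes_inverses(2)[OF p])
    ultimately show "y \<in> (\<lambda>x. \<chi> i. x $ p i) ` cbox a b"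
      by blast
  qed (auto simp: mem_box_cart)
  show ?thesis
  proof (cases "cbox a b = {}")
    case False
    then have "cbox (\<chi> i. a $ p i) (\<chi> i. b $ p i) \<noteq> {}"
      by (simp add: eq[symmetric])
    then show ?thesis
      using False prod.permute[OF p, of "\<lambda>i. b $ i - a $ i"]
      by (simp add: eq content_cbox_cart o_def)
  qed simp
qed

text \<open>
  A translation along the \<open>n\<close>-axis reduces this to a box with nonnegative \<open>n\<close>-coordinates.
\<close>

lemma measure_sheared_cbox:
  fixes a b :: "real ^ 'n::finite"
  assumes "m \<noteq> n"
  shows "measure lebesgue ((\<lambda>x. \<chi> i. if i = m then x $ m + x $ n else x $ i) ` cbox a b) =
         measure lebesgue (cbox a b)"
proof (cases "cbox a b = {}")
  case False
  define h :: "real ^ 'n \<Rightarrow> real ^ 'n" where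
    "h x = (\<chi> i. if i = m then x $ m + x $ n else x $ i)" for x
  define t :: "real ^ 'n" where "t = - (a $ n *\<^sub>R axis n 1)"
  have h: "h x = (- h t) + h (t + x)" for x
    by (auto simp: h_def vec_eq_iff algebra_simps)
  have "h ` cbox a b = (+) (- h t) ` h ` (cbox (t + a) (t + b))"
    unfolding cbox_translation image_image by (rule image_cong[OF refl h])
  then have "measure lebesgue (h ` cbox a b) = measure lebesgue (h ` cbox (t + a) (t + b))"
    by (simp only: measure_translation)
  also have "\<dots> = measure lebesgue (cbox (t + a) (t + b))"
  proof -
    have "cbox (t + a) (t + b) \<noteq> {}"
      using False by (simp add: cbox_translation)
    moreover have "0 \<le> (t + a) $ n"
      by (simp add: t_def)
    ultimately show ?thesis
      unfolding h_def by (rule measure_shear_interval[OF assms])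
  qed
  also have "\<dots> = measure lebesgue (cbox a b)"
    by (simp only: cbox_translation measure_translation)
  finally show ?thesis by (simp add: h_def)
qed simp

text \<open>
  Linear maps are generated by singular maps, coordinate scalings, swaps and shears. A swap or a
  shear is a row operation applied to the identity matrix, which gives its determinant without
  any ordering of the index type.
\<close>

lemma measure_linear_image_finite:
  fixes f :: "real ^ 'n::finite \<Rightarrow> real ^ 'n"
  assumes "linear f" "S \<in> lmeasurable"
  shows "f ` S \<in> lmeasurable \<and> measure lebesgue (f ` S) = \<bar>det (matrix f)\<bar> * measure lebesgue S"
proof -
  have "\<forall>S\<in>lmeasurable. f ` S \<in> lmeasurable \<and>
          measure lebesgue (f ` S) = \<bar>det (matrix f)\<bar> * measure lebesgue S"
    (is "?P f")
  proof (rule induct_linear_elementary[OF assms(1), of ?P])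
    fix f g :: "real ^ 'n \<Rightarrow> real ^ 'n"
    assume "linear f" "linear g" "?P f" "?P g"
    then show "?P (f \<circ> g)"
      by (simp add: image_comp[symmetric] matrix_compose det_mul abs_mult del: o_apply)
  next
    fix f :: "real ^ 'n \<Rightarrow> real ^ 'n" and i
    assume f: "linear f" "\<And>x. f x $ i = 0"
    then have "\<not> inj f"
      by (metis (full_types) linear_injective_imp_surjective one_neq_zero surjE vec_component)
    then have "det (matrix f) = 0" "negligible (f ` S)" for S
      using f det_nz_iff_inj negligible_linear_singular_image by blast+
    then show "?P f"
      using negligible_iff_measure by auto
  next
    fix c :: "'n \<Rightarrow> real"
    have "det (matrix (\<lambda>x. \<chi> i. c i * x $ i)) = prod c UNIV"
      by (simp add: matrix_def axis_def det_diagonal)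
    then show "?P (\<lambda>x. \<chi> i. c i * x $ i)"
      by (simp add: measurable_stretch measure_stretch)
  next
    fix m n :: 'n
    let ?p = "Transposition.transpose m n" and ?h = "\<lambda>x::real ^ 'n. \<chi> i. x $ Transposition.transpose m n i"
    have "matrix ?h = (\<chi> i. (mat 1 :: real ^ 'n ^ 'n) $ ?p i)"
      by (auto simp: matrix_def mat_def vec_eq_iff axis_def)
    then have det: "\<bar>det (matrix ?h)\<bar> = 1"
      using det_permute_rows[OF permutes_swap_id[of m UNIV n, OF UNIV_I UNIV_I], of "mat 1 :: real ^ 'n ^ 'n"]
      by (simp add: abs_mult sign_def)
    have lin: "linear ?h"
      by (rule linearI) (simp_all add: vec_eq_iff)
    note suff = measure_linear_sufficient[OF lin _ trans[OF measure_permuted_cbox[OF permutes_swap_id[of m UNIV n, OF UNIV_I UNIV_I]] mult_1[symmetric]]]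
    have "?h ` S \<in> lmeasurable" "measure lebesgue (?h ` S) = measure lebesgue S"
      if "S \<in> lmeasurable" for S
      using suff[OF that] by (blast, simp only: mult_1)
    then show "?P ?h"
      unfolding det mult_1 by blast
  next
    fix m n :: 'n
    assume mn: "m \<noteq> n"
    let ?h = "\<lambda>x::real ^ 'n. \<chi> i. if i = m then x $ m + x $ n else x $ i"
    have "matrix ?h = (\<chi> k. if k = m then row m (mat 1) + 1 *s row n (mat 1) else row k (mat 1))"
      by (auto simp: matrix_def mat_def vec_eq_iff axis_def row_def)
    then have det: "\<bar>det (matrix ?h)\<bar> = 1"
      using det_row_operation[OF mn, of "mat 1 :: real ^ 'n ^ 'n" 1] by simp
    have lin: "linear ?h"
      by (rule linearI) (simp_all add: vec_eq_iff algebra_simps)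
    note suff = measure_linear_sufficient[OF lin _ trans[OF measure_sheared_cbox[OF mn] mult_1[symmetric]]]
    have "?h ` S \<in> lmeasurable" "measure lebesgue (?h ` S) = measure lebesgue S"
      if "S \<in> lmeasurable" for S
      using suff[OF that] by (blast, simp only: mult_1)
    then show "?P ?h"
      unfolding det mult_1 by blast
  qed
  then show ?thesis using assms(2) by blast
qed

lemma lborel_eq_density_distr_matrix:
  fixes A :: "real ^ 'n::finite ^ 'n"
  assumes "det A \<noteq> 0"
  shows "lborel = density (distr lborel borel ((*v) A)) (\<lambda>_. ennreal \<bar>det A\<bar>)"
proof (rule lborel_eqI)
  obtain B where B: "A ** B = mat 1" "B ** A = mat 1"
    using assms invertible_det_nz invertible_def by metis
  have detB: "det A * det B = 1"
    using B(1) by (metis det_I det_mul)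
  fix l u :: "real ^ 'n"
  assume le: "\<And>b. b \<in> Basis \<Longrightarrow> l \<bullet> b \<le> u \<bullet> b"
  have meas [measurable]: "(*v) A \<in> borel_measurable borel"
    by (intro borel_measurable_continuous_onI continuous_intros)
  have vim: "(*v) A -` box l u = (*v) B ` box l u"
  proof (intro set_eqI iffI)
    fix x assume "x \<in> (*v) A -` box l u"
    moreover have "x = B *v (A *v x)"
      by (simp add: matrix_vector_mul_assoc B)
    ultimately show "x \<in> (*v) B ` box l u" by blast
  qed (auto simp: matrix_vector_mul_assoc B)
  have lin: "(*v) B ` box l u \<in> lmeasurable"
    "measure lebesgue ((*v) B ` box l u) = \<bar>det B\<bar> * measure lebesgue (box l u)"
    using measure_linear_image_finite[of "(*v) B" "box l u"] by (simp_all add: matrix_of_matrix_vector_mul)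
  have borel: "(*v) B ` box l u \<in> sets borel"
    unfolding vim[symmetric] by (intro measurable_sets_borel[OF meas]) simp
  have "emeasure lborel ((*v) B ` box l u) = emeasure lebesgue ((*v) B ` box l u)"
    using borel by simp
  also have "\<dots> = ennreal (\<bar>det B\<bar> * measure lebesgue (box l u))"
    using lin by (metis emeasure_eq_measure2)
  finally have em: "emeasure lborel ((*v) B ` box l u) = ennreal (\<bar>det B\<bar> * measure lebesgue (box l u))" .
  have "emeasure (density (distr lborel borel ((*v) A)) (\<lambda>_. ennreal \<bar>det A\<bar>)) (box l u)
      = ennreal \<bar>det A\<bar> * emeasure lborel ((*v) A -` box l u)"
    by (simp add: emeasure_density nn_integral_cmult emeasure_distr)
  also have "\<dots> = ennreal (\<bar>det A * det B\<bar> * measure lebesgue (box l u))"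
    by (simp add: vim em ennreal_mult'[symmetric] abs_mult mult.assoc)
  also have "\<dots> = (\<Prod>b\<in>Basis. (u - l) \<bullet> b)"
    using detB le by (simp add: measure_lborel_box_eq)
  finally show "emeasure (density (distr lborel borel ((*v) A)) (\<lambda>_. ennreal \<bar>det A\<bar>)) (box l u) =
    ennreal (\<Prod>b\<in>Basis. (u - l) \<bullet> b)" .
qed simp

lemma integral_lborel_matrix:
  fixes A :: "real ^ 'n::finite ^ 'n" and g :: "real ^ 'n \<Rightarrow> real"
  assumes "det A \<noteq> 0" and [measurable]: "g \<in> borel_measurable borel"
  shows "(\<integral>x. g x \<partial>lborel) = \<bar>det A\<bar> * (\<integral>x. g (A *v x) \<partial>lborel)"
proof -
  have [measurable]: "(*v) A \<in> borel_measurable borel"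
    by (intro borel_measurable_continuous_onI continuous_intros)
  show ?thesis
    by (subst lborel_eq_density_distr_matrix[OF assms(1)])
      (simp add: integral_density integral_distr)
qed

section \<open>Laplace expansion into fragment determinants\<close>

lemma fragment_Inl: "fragment \<sigma> M $ Inl s $ j = (if j \<in> \<sigma> then M $ Inl s $ j else 0)"
  by (simp add: fragment_def stack_def cvec_def first_part_def column_def)

lemma fragment_Inr: "fragment \<sigma> M $ Inr t $ j = (if j \<in> \<sigma> then 0 else - M $ Inr t $ j)"
  by (simp add: fragment_def stack_def cbar_def last_part_def column_def)

lemma prod_UNIV_sum_type:
  fixes f :: "'r::finite + 'k::finite \<Rightarrow> 'a::comm_monoid_mult"
  shows "(\<Prod>i\<in>UNIV. f i) = (\<Prod>s\<in>UNIV. f (Inl s)) * (\<Prod>t\<in>UNIV. f (Inr t))"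
  unfolding UNIV_sum
  by (subst prod.union_disjoint) (auto simp: prod.reindex)

lemma sum_UNIV_sum_type:
  fixes f :: "'r::finite + 'k::finite \<Rightarrow> 'a::comm_monoid_add"
  shows "(\<Sum>i\<in>UNIV. f i) = (\<Sum>s\<in>UNIV. f (Inl s)) + (\<Sum>t\<in>UNIV. f (Inr t))"
  unfolding UNIV_sum
  by (subst sum.union_disjoint) (auto simp: sum.reindex)

text \<open>
  Laplace expansion along the first \<open>r\<close> rows: in the Leibniz formula a permutation \<open>p\<close>
  contributes only to the fragment matrix of the set \<open>\<sigma>\<close> of columns that \<open>p\<close> assigns
  to these rows. The weights \<open>\<alpha> j\<close> and \<open>\<beta> j\<close> on the two halves of column \<open>j\<close> are later
  the Fourier integrals along its two edges.
\<close>

lemma sum_det_fragment: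
  fixes M :: "real ^ ('r::finite + 'k::finite) ^ ('r + 'k)"
    and \<alpha> \<beta> :: "'r + 'k \<Rightarrow> 'a::{comm_ring_1, real_algebra_1}"
  shows "(\<Sum>\<sigma> | card \<sigma> = CARD('r).
           (\<Prod>j\<in>UNIV. if j \<in> \<sigma> then \<alpha> j else \<beta> j) * of_real (det (fragment \<sigma> M))) =
         det (\<chi> i j. case i of Inl s \<Rightarrow> \<alpha> j * of_real (M $ i $ j)
                             | Inr t \<Rightarrow> - \<beta> j * of_real (M $ i $ j) :: 'a ^ ('r + 'k) ^ ('r + 'k))"
    (is "_ = det ?K")
proof -
  let ?P = "{p. p permutes (UNIV :: ('r + 'k) set)}"
  let ?S = "{\<sigma> :: ('r + 'k) set. card \<sigma> = CARD('r)}"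
  define \<gamma> where "\<gamma> \<sigma> j = (if j \<in> \<sigma> then \<alpha> j else \<beta> j)" for \<sigma> j
  have prod_fragment: "(\<Prod>i\<in>UNIV. \<gamma> \<sigma> (p i) * of_real (fragment \<sigma> M $ i $ p i)) =
      (if \<sigma> = p ` range Inl then \<Prod>i\<in>UNIV. ?K $ i $ p i else 0)"
    if p: "p permutes UNIV" and \<sigma>: "\<sigma> \<in> ?S" for p \<sigma>
  proof (cases "\<sigma> = p ` range Inl")
    case True
    have "inj p" using p by (rule permutes_inj)
    then have "p (Inl s) \<in> \<sigma>" "p (Inr t) \<notin> \<sigma>" for s t
      by (auto simp: True inj_image_mem_iff)
    then show ?thesis
      using True by (simp add: prod_UNIV_sum_type \<gamma>_def fragment_Inl fragment_Inr)
  next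
    case False
    have card: "card (p ` range (Inl :: 'r \<Rightarrow> 'r + 'k)) = card \<sigma>"
      using \<sigma> p by (simp add: card_image permutes_inj_on)
    have "\<not> p ` range Inl \<subseteq> \<sigma>"
      using False card_subset_eq[OF _ _ card] by auto
    then obtain s where "p (Inl s) \<notin> \<sigma>" by auto
    then have "fragment \<sigma> M $ Inl s $ p (Inl s) = 0"
      by (simp add: fragment_Inl)
    then have "(\<Prod>i\<in>UNIV. \<gamma> \<sigma> (p i) * of_real (fragment \<sigma> M $ i $ p i)) = 0"
      by (intro prod_zero bexI[of _ "Inl s"]) simp_all
    then show ?thesis using False by simp
  qed
  have summand: "(\<Prod>j\<in>UNIV. \<gamma> \<sigma> j) * of_real (det (fragment \<sigma> M)) =
      (\<Sum>p\<in>?P. of_int (sign p) * (\<Prod>i\<in>UNIV. \<gamma> \<sigma> (p i) * of_real (fragment \<sigma> M $ i $ p i)))" for \<sigma>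
  proof -
    have "(\<Prod>j\<in>UNIV. \<gamma> \<sigma> j) = (\<Prod>i\<in>UNIV. \<gamma> \<sigma> (p i))" if "p \<in> ?P" for p
      using that prod.permute[of p UNIV "\<gamma> \<sigma>"] by (simp add: o_def)
    then show ?thesis
      by (simp add: det_def sum_distrib_left prod.distrib mult_ac)
  qed
  have "(\<Sum>\<sigma>\<in>?S. (\<Prod>j\<in>UNIV. \<gamma> \<sigma> j) * of_real (det (fragment \<sigma> M))) =
      (\<Sum>p\<in>?P. \<Sum>\<sigma>\<in>?S. of_int (sign p) * (if \<sigma> = p ` range Inl then \<Prod>i\<in>UNIV. ?K $ i $ p i else 0))"
    unfolding summand by (subst sum.swap) (intro sum.cong refl, simp add: prod_fragment)
  also have "\<dots> = (\<Sum>p\<in>?P. of_int (sign p) * (\<Prod>i\<in>UNIV. ?K $ i $ p i))"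
  proof (intro sum.cong refl)
    fix p assume p: "p \<in> ?P"
    then have "card (p ` range (Inl :: 'r \<Rightarrow> 'r + 'k)) = CARD('r)"
      by (simp add: card_image permutes_inj_on)
    then show "(\<Sum>\<sigma>\<in>?S. of_int (sign p) * (if \<sigma> = p ` range Inl then \<Prod>i\<in>UNIV. ?K $ i $ p i else 0)) =
        of_int (sign p) * (\<Prod>i\<in>UNIV. ?K $ i $ p i)"
      by (simp add: if_distrib sum.delta cong: if_cong)
  qed
  finally show ?thesis
    by (simp add: \<gamma>_def det_def)
qed

lemma sum_det_fragment_1:
  fixes M :: "real ^ ('r::finite + 'k::finite) ^ ('r + 'k)"
  shows "(\<Sum>\<sigma> | card \<sigma> = CARD('r). det (fragment \<sigma> M)) = (-1) ^ CARD('k) * det M"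
proof -
  have "(\<Sum>\<sigma> | card \<sigma> = CARD('r). det (fragment \<sigma> M)) =
    det (\<chi> i j. case i of Inl s \<Rightarrow> M $ i $ j | Inr t \<Rightarrow> - M $ i $ j)"
    using sum_det_fragment[of "\<lambda>_. 1::real" "\<lambda>_. 1" M] by (simp cong: sum.case_cong)
  also have "\<dots> = (-1) ^ CARD('k) * det M"
    unfolding det_def
    by (simp add: prod_UNIV_sum_type prod_uminus sum_distrib_left mult_ac)
  finally show ?thesis .
qed

lemma det_eq_0_if_left_null:
  fixes A :: "'a::field ^ 'n::finite ^ 'n"
  assumes "v v* A = 0" "v \<noteq> 0"
  shows "det A = 0"
proof (rule ccontr)
  assume "det A \<noteq> 0"
  then obtain B where "A ** B = mat 1"
    using invertible_det_nz invertible_def by metis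
  then have "v = (v v* A) v* B"
    by (simp add: vector_matrix_mul_assoc)
  with assms show False by simp
qed

section \<open>Fourier coefficients of the signed count\<close>

abbreviation unit_cube :: "(real ^ 'n::finite) set" where
  "unit_cube \<equiv> cbox 0 1"

definition wave :: "real ^ 'n::finite \<Rightarrow> real ^ 'n \<Rightarrow> complex" where
  "wave m x = exp (2 * pi * \<i> * of_real (m \<bullet> x))"

definition wave_integral :: "real \<Rightarrow> complex" where
  "wave_integral s = (\<integral>t. indicator {0..1} t *\<^sub>R exp (2 * pi * \<i> * of_real (s * t)) \<partial>lborel)"

text \<open>
  The form without division by \<open>s\<close> also covers \<open>s = 0\<close>.
\<close>

lemma wave_integral_times_frequency:
  "of_real s * wave_integral s = (exp (2 * pi * \<i> * of_real s) - 1) / (2 * pi * \<i>)"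
proof -
  define c where "c = 2 * pi * \<i> * of_real s"
  have "c * wave_integral s = (\<integral>t. indicator {0..1} t *\<^sub>R (c * exp (c * of_real t)) \<partial>lborel)"
    unfolding wave_integral_def c_def by (subst integral_mult_right_zero[symmetric]) (simp add: mult_ac)
  also have "\<dots> = exp (c * of_real 1) - exp (c * of_real 0)"
    by (rule integral_FTC_atLeastAtMost)
      (auto intro!: derivative_eq_intros continuous_intros
        has_vector_derivative_real_field[THEN has_vector_derivative_at_within])
  finally have "of_real s * wave_integral s * (2 * pi * \<i>) = exp (2 * pi * \<i> * of_real s) - 1"
    by (simp add: c_def mult_ac)
  then show ?thesis
    by (intro eq_divide_imp) simp_all
qed

lemma wave_integral_0: "wave_integral 0 = 1"
  by (simp add: wave_integral_def)

lemma wave_integral_Ints: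
  assumes "s \<in> \<int>" "s \<noteq> 0"
  shows "wave_integral s = 0"
proof -
  from assms(1) obtain n where n: "s = of_int n" by (rule Ints_cases)
  have "exp (2 * pi * \<i> * of_real s) = 1"
    using exp_integer_2pi[of "of_int n"] by (simp add: n mult_ac)
  then show ?thesis
    using wave_integral_times_frequency[of s] assms(2) by simp
qed

lemma prod_Basis_cart:
  fixes g :: "real ^ 'n::finite \<Rightarrow> 'a::comm_monoid_mult"
  shows "(\<Prod>b\<in>Basis. g b) = (\<Prod>i\<in>UNIV. g (axis i 1))"
proof -
  have "(Basis :: (real ^ 'n) set) = range (\<lambda>i. axis i 1)"
    by (auto simp: Basis_vec_def)
  moreover have "inj (\<lambda>i::'n. axis i (1::real))"
    by (auto simp: inj_on_def axis_eq_axis)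
  ultimately show ?thesis
    by (metis prod.reindex_cong[OF _ _ refl])
qed

lemma one_inner_Basis_cart: "b \<in> Basis \<Longrightarrow> (1 :: real ^ 'n::finite) \<bullet> b = 1"
  by (auto simp: Basis_vec_def inner_axis)

text \<open>
  The wave is a product of functions of one coordinate each, so Fubini applies.
\<close>

lemma integral_unit_cube_wave:
  fixes s :: "real ^ 'n::finite"
  shows "(LINT x:unit_cube|lborel. wave s x) = (\<Prod>i\<in>UNIV. wave_integral (s $ i))"
proof -
  interpret product_sigma_finite "\<lambda>_::real ^ 'n. lborel :: real measure" ..
  let ?g = "\<lambda>b t. indicator {0..1} t *\<^sub>R exp (2 * pi * \<i> * of_real ((s \<bullet> b) * t))"
  let ?T = "\<lambda>f. \<Sum>b\<in>Basis. f b *\<^sub>R b :: real ^ 'n"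
  have factor: "indicator unit_cube (?T f) *\<^sub>R wave s (?T f) = (\<Prod>b\<in>Basis. ?g b (f b))" for f
  proof -
    have "?T f \<in> unit_cube \<longleftrightarrow> (\<forall>b\<in>Basis. f b \<in> {0..1})"
      by (auto simp: mem_box one_inner_Basis_cart)
    then have "indicator unit_cube (?T f) = (\<Prod>b\<in>Basis. indicator {0..1} (f b) :: real)"
      by (cases "?T f \<in> unit_cube") (auto simp: prod_zero_iff indicator_def)
    moreover have "wave s (?T f) = (\<Prod>b\<in>Basis. exp (2 * pi * \<i> * of_real ((s \<bullet> b) * f b)))"
      by (simp add: wave_def inner_sum_right sum_distrib_left exp_sum mult_ac)
    ultimately show ?thesis
      by (simp add: scaleR_conv_of_real prod.distrib)
  qed
  have "(LINT x:unit_cube|lborel. wave s x) =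
      (\<integral>f. indicator unit_cube (?T f) *\<^sub>R wave s (?T f) \<partial>(\<Pi>\<^sub>M b\<in>Basis. lborel))"
    unfolding set_lebesgue_integral_def wave_def
    by (subst lborel_eq, subst integral_distr) (auto intro!: borel_measurable_continuous_onI continuous_intros)
  also have "\<dots> = (\<Prod>b\<in>Basis. \<integral>t. ?g b t \<partial>lborel)"
    unfolding factor
    by (intro product_integral_prod borel_integrable_compact) (auto intro!: continuous_intros)
  also have "\<dots> = (\<Prod>i\<in>UNIV. wave_integral (s $ i))"
    by (simp add: prod_Basis_cart wave_integral_def inner_axis)
  finally show ?thesis .
qed

text \<open>
  The heart of the proof. Put \<open>\<xi> = m v* M'\<close>, the frequency in the original coordinates, and let
  \<open>s j\<close> and \<open>t j\<close> be the parts of \<open>(\<xi> v* M) $ j = m $ j\<close> that come from the first \<open>r\<close> and from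
  the last \<open>k\<close> rows. The integral over the parallelepiped of \<open>\<sigma>\<close> is a product with factor
  \<open>wave_integral (s j)\<close> for \<open>j \<in> \<sigma>\<close> and \<open>wave_integral (- t j)\<close> for \<open>j \<notin> \<sigma>\<close>, so the sum over
  \<open>\<sigma>\<close> is the Laplace expansion of one determinant. Since \<open>s j\<close> and \<open>- t j\<close> differ by the integer
  \<open>m $ j\<close>, \<open>s j * wave_integral (s j) = - t j * wave_integral (- t j)\<close>, and this says that \<open>\<xi>\<close>, with
  its last \<open>k\<close> entries negated, is a left null vector. So the determinant vanishes unless
  \<open>m = 0\<close>; for \<open>m = 0\<close> the identity is the plain Laplace expansion of \<open>det M\<close>.
\<close>

lemma fragment_wave_identity:
  fixes M M' :: "real ^ ('r::finite + 'k::finite) ^ ('r + 'k)"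
  assumes inv: "M' ** M = mat 1" and m: "\<And>i. m $ i \<in> \<int>"
  shows "(\<Sum>\<sigma> | card \<sigma> = CARD('r).
           of_real (det (fragment \<sigma> M)) * (LINT x:unit_cube|lborel. wave m (M' *v (fragment \<sigma> M *v x)))) =
         (-1) ^ CARD('k) * of_real (det M) * (LINT x:unit_cube|lborel. wave m x)"
proof -
  define \<xi> where "\<xi> = m v* M'"
  have \<xi>M: "\<xi> v* M = m"
    by (simp add: \<xi>_def vector_matrix_mul_assoc inv)
  define s t where "s j = (\<Sum>a\<in>UNIV. \<xi> $ Inl a * M $ Inl a $ j)"
    and "t j = (\<Sum>b\<in>UNIV. \<xi> $ Inr b * M $ Inr b $ j)" for j
  have st: "s j + t j = m $ j" for j
    by (simp add: \<xi>M[symmetric] vector_matrix_mult_def sum_UNIV_sum_type s_def t_def mult_ac)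
  have freq: "(\<xi> v* fragment \<sigma> M) $ j = (if j \<in> \<sigma> then s j else - t j)" for \<sigma> j
    by (simp add: vector_matrix_mult_def sum_UNIV_sum_type s_def t_def fragment_Inl fragment_Inr
        sum_negf mult_ac)
  have "m \<bullet> (M' *v (fragment \<sigma> M *v x)) = (\<xi> v* fragment \<sigma> M) \<bullet> x" for \<sigma> x
    by (simp add: \<xi>_def dot_lmul_matrix)
  then have "wave m (M' *v (fragment \<sigma> M *v x)) = wave (\<xi> v* fragment \<sigma> M) x" for \<sigma> x
    by (simp add: wave_def)
  then have int: "(LINT x:unit_cube|lborel. wave m (M' *v (fragment \<sigma> M *v x))) =
      (\<Prod>j\<in>UNIV. if j \<in> \<sigma> then wave_integral (s j) else wave_integral (- t j))" for \<sigma>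
    by (simp add: integral_unit_cube_wave freq if_distrib)
  show ?thesis
  proof (cases "m = 0")
    case True
    then have zero: "s j = 0" "t j = 0" for j
      by (simp_all add: s_def t_def \<xi>_def)
    show ?thesis
      unfolding int integral_unit_cube_wave
      using arg_cong[OF sum_det_fragment_1[of M], of complex_of_real]
      by (simp add: zero True wave_integral_0 cong: if_cong)
  next
    case False
    then obtain i where "m $ i \<noteq> 0" by (auto simp: vec_eq_iff)
    then have rhs: "(LINT x:unit_cube|lborel. wave m x) = 0"
      using m wave_integral_Ints by (auto simp: integral_unit_cube_wave)
    have phase: "of_real (s j) * wave_integral (s j) + of_real (t j) * wave_integral (- t j) = 0" for j
    proof -
      obtain n where "m $ j = of_int n"
        using m by (metis Ints_cases)
      then have sj: "s j = - t j + of_int n"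
        using st[of j] by simp
      have "exp (2 * pi * \<i> * of_real (s j)) = exp (2 * pi * \<i> * of_real (- t j)) * exp (2 * of_int n * pi * \<i>)"
        unfolding exp_add[symmetric] sj by (intro arg_cong[where f = exp]) (simp add: algebra_simps)
      also have "exp (2 * of_int n * pi * \<i>) = 1"
        by (rule exp_integer_2pi) simp
      finally have "of_real (s j) * wave_integral (s j) = of_real (- t j) * wave_integral (- t j)"
        unfolding wave_integral_times_frequency by simp
      then show ?thesis by simp
    qed
    let ?K = "\<chi> i j. case i of Inl a \<Rightarrow> wave_integral (s j) * of_real (M $ i $ j)
                             | Inr b \<Rightarrow> - wave_integral (- t j) * of_real (M $ i $ j)"
    let ?v = "\<chi> i. case i of Inl a \<Rightarrow> of_real (\<xi> $ i) | Inr b \<Rightarrow> - of_real (\<xi> $ i) :: complex"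
    have "(?v v* ?K) $ j = 0" for j
    proof -
      have "(?v v* ?K) $ j = of_real (s j) * wave_integral (s j) + of_real (t j) * wave_integral (- t j)"
        by (simp add: vector_matrix_mult_def sum_UNIV_sum_type s_def t_def sum_distrib_left
            sum_distrib_right sum_negf mult_ac)
      then show ?thesis by (simp add: phase)
    qed
    then have "?v v* ?K = 0" by (simp add: vec_eq_iff)
    moreover have "?v \<noteq> 0"
    proof
      assume v: "?v = 0"
      have "\<xi> $ i = 0" for i
        using arg_cong[OF v, of "\<lambda>u. u $ i"] by (cases i) simp_all
      then have "\<xi> = 0" by (simp add: vec_eq_iff)
      then show False
        using \<open>m \<noteq> 0\<close> \<xi>M by simp
    qed
    ultimately have "det ?K = 0" by (rule det_eq_0_if_left_null)
    then show ?thesis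
      using sum_det_fragment[of "\<lambda>j. wave_integral (s j)" "\<lambda>j. wave_integral (- t j)" M]
      by (simp add: rhs int mult.commute)
  qed
qed

section \<open>From waves to continuous periodic functions\<close>

text \<open>
  The complex linear span of the waves of integer frequency, which are the periodic ones.
\<close>

inductive trig_poly :: "(real ^ 'n::finite \<Rightarrow> complex) \<Rightarrow> bool" where
  wave: "(\<And>i. m $ i \<in> \<int>) \<Longrightarrow> trig_poly (\<lambda>x. c * wave m x)"
| add: "trig_poly f \<Longrightarrow> trig_poly g \<Longrightarrow> trig_poly (\<lambda>x. f x + g x)"

lemma continuous_on_wave [continuous_intros]:
  "continuous_on S f \<Longrightarrow> continuous_on S (\<lambda>x. wave m (f x))"
  unfolding wave_def by (intro continuous_intros)

lemma trig_poly_const: "trig_poly (\<lambda>x. c)"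
  using trig_poly.wave[of 0 c] by (simp add: wave_def)

lemma trig_poly_sum:
  "(\<And>i. i \<in> I \<Longrightarrow> trig_poly (f i)) \<Longrightarrow> trig_poly (\<lambda>x. \<Sum>i\<in>I. f i x)"
  by (induction I rule: infinite_finite_induct) (auto intro: trig_poly.add trig_poly_const)

lemma trig_poly_mult:
  assumes "trig_poly f" "trig_poly g"
  shows "trig_poly (\<lambda>x. f x * g x)"
  using assms(1)
proof induction
  case (wave m c)
  note m = wave
  from assms(2) show ?case
  proof induction
    case (wave n d)
    have "wave m x * wave n x = wave (m + n) x" for x
      by (simp add: wave_def exp_add[symmetric] inner_add_left algebra_simps)
    then have "(\<lambda>x. c * wave m x * (d * wave n x)) = (\<lambda>x. (c * d) * wave (m + n) x)"
      by (metis mult.assoc mult.left_commute)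
    then show ?case
      using m wave by (auto intro!: trig_poly.wave)
  qed (auto simp: ring_distribs intro: trig_poly.add)
qed (auto simp: ring_distribs intro: trig_poly.add)

lemma continuous_on_trig_poly: "trig_poly f \<Longrightarrow> continuous_on S f"
  by (induction rule: trig_poly.induct) (auto intro!: continuous_intros)

text \<open>
  The quotient by the integer lattice, realised as a subset of a Euclidean space so that the
  Stone--Weierstrass theorem for polynomial functions applies to periodic functions.
\<close>

definition torus :: "real ^ 'n::finite \<Rightarrow> complex ^ 'n" where
  "torus x = (\<chi> i. exp (2 * pi * \<i> * of_real (x $ i)))"

lemma continuous_on_torus [continuous_intros]:
  "continuous_on S f \<Longrightarrow> continuous_on S (\<lambda>x. torus (f x))"
  unfolding torus_def by (intro continuous_intros)

lemma trig_poly_Re_Im_torus: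
  "trig_poly (\<lambda>x. of_real (Re (torus x $ i)))" "trig_poly (\<lambda>x. of_real (Im (torus x $ i)))"
proof -
  have w: "wave (axis i 1) x = torus x $ i" "wave (- axis i 1) x = cnj (torus x $ i)" for x
    by (simp_all add: wave_def torus_def inner_axis' exp_cnj)
  have p: "trig_poly (\<lambda>x. c * wave (axis i 1) x + d * wave (- axis i 1) x)" for c d
    by (intro trig_poly.intros) (auto simp: axis_def)
  have "of_real (Re z) = 1/2 * z + 1/2 * cnj z" "of_real (Im z) = (- \<i>/2) * z + (\<i>/2) * cnj z" for z
    by (auto simp: complex_eq_iff)
  then show "trig_poly (\<lambda>x. of_real (Re (torus x $ i)))" "trig_poly (\<lambda>x. of_real (Im (torus x $ i)))"
    using p[of "1/2" "1/2"] p[of "- \<i>/2" "\<i>/2"] by (simp_all only: w)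
qed

lemma trig_poly_real_polynomial_torus:
  fixes g :: "complex ^ 'n::finite \<Rightarrow> real"
  assumes "real_polynomial_function g"
  shows "trig_poly (\<lambda>x. of_real (g (torus x)))"
  using assms
proof induction
  case (linear g)
  then interpret bounded_linear g .
  have expand: "\<zeta> = (\<Sum>i\<in>UNIV. Re (\<zeta> $ i) *\<^sub>R axis i 1 + Im (\<zeta> $ i) *\<^sub>R axis i \<i>)"
    for \<zeta> :: "complex ^ 'n"
    by (simp add: vec_eq_iff axis_def complex_eq_iff if_distrib if_distribR cong: if_cong)
  have "g \<zeta> = (\<Sum>i\<in>UNIV. g (axis i 1) * Re (\<zeta> $ i) + g (axis i \<i>) * Im (\<zeta> $ i))" for \<zeta>
    by (subst expand) (simp only: sum add scaleR real_scaleR_def mult.commute)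
  from this[of "torus _"] have eq: "(\<lambda>x. complex_of_real (g (torus x))) =
      (\<lambda>x. \<Sum>i\<in>UNIV. of_real (g (axis i 1)) * of_real (Re (torus x $ i)) +
                      of_real (g (axis i \<i>)) * of_real (Im (torus x $ i)))"
    by (intro ext) (simp only: of_real_sum[symmetric] of_real_add[symmetric] of_real_mult[symmetric])
  show ?case
    unfolding eq
    by (intro trig_poly_sum trig_poly.add trig_poly_mult trig_poly_const trig_poly_Re_Im_torus)
qed (simp_all add: trig_poly_const trig_poly.add trig_poly_mult)

lemma set_integrable_unit_cube:
  fixes f :: "real ^ 'n::finite \<Rightarrow> 'b::{banach, second_countable_topology}"
  assumes "continuous_on UNIV f"
  shows "set_integrable lborel unit_cube f"
  unfolding set_integrable_def
  by (intro borel_integrable_compact) (auto intro: continuous_on_subset[OF assms])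

lemma set_integral_unit_cube_bound:
  fixes f :: "real ^ 'n::finite \<Rightarrow> real"
  assumes "continuous_on UNIV f" "\<And>x. \<bar>f x\<bar> \<le> e"
  shows "\<bar>LINT x:unit_cube|lborel. f x\<bar> \<le> e"
proof -
  have "\<bar>LINT x:unit_cube|lborel. f x\<bar> \<le> (LINT x:unit_cube|lborel. \<bar>f x\<bar>)"
    using set_integral_norm_bound[OF set_integrable_unit_cube[OF assms(1)]] by simp
  also have "\<dots> \<le> (LINT x:(unit_cube :: (real ^ 'n) set)|lborel. e)"
    using assms by (intro set_integral_mono set_integrable_unit_cube continuous_intros) auto
  also have "\<dots> = e"
    using interval_ne_empty_cart(1)[of 0 "1 :: real ^ 'n"]
    by (simp add: set_lebesgue_integral_def content_cbox_cart)
  finally show ?thesis .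
qed

text \<open>
  For a function \<open>f\<close> of lattice coordinates, the integral of \<open>f\<close> against the signed tile count
  minus its integral against the expected constant, both scaled by \<open>\<bar>det M\<bar>\<close>; the factor \<open>det (fragment \<sigma> M)\<close> is the signed
  Jacobian of the parametrisation of the tile by the unit cube. The values of \<open>f\<close> may be real or
  complex: the waves are complex, the bump functions real.
\<close>

definition fragment_defect ::
  "real ^ ('r::finite + 'k::finite) ^ ('r + 'k) \<Rightarrow> real ^ ('r + 'k) ^ ('r + 'k) \<Rightarrow>
   (real ^ ('r + 'k) \<Rightarrow> 'a::{banach, second_countable_topology, real_normed_algebra_1}) \<Rightarrow> 'a" where
  "fragment_defect M M' f =
     (\<Sum>\<sigma> | card \<sigma> = CARD('r).
        of_real (det (fragment \<sigma> M)) * (LINT x:unit_cube|lborel. f (M' *v (fragment \<sigma> M *v x)))) -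
     (-1) ^ CARD('k) * of_real (det M) * (LINT x:unit_cube|lborel. f x)"

lemma fragment_defect_add:
  fixes f g :: "real ^ ('r::finite + 'k::finite) \<Rightarrow> 'a::{banach, second_countable_topology, real_normed_algebra_1}"
  assumes "continuous_on UNIV f" "continuous_on UNIV g"
  shows "fragment_defect M M' (\<lambda>x. f x + g x) = fragment_defect M M' f + fragment_defect M M' g"
proof -
  have "continuous_on UNIV (\<lambda>x. h (A *v (B *v x)))"
    if "continuous_on UNIV h" for h :: "real ^ ('r + 'k) \<Rightarrow> 'a" and A B :: "real ^ ('r + 'k) ^ ('r + 'k)"
    by (rule continuous_on_compose2[OF that])
      (auto simp: matrix_vector_mul_assoc matrix_vector_mult_linear_continuous_on)
  then show ?thesis
    using assms
    by (simp add: fragment_defect_def set_integral_add set_integrable_unit_cube sum.distrib ring_distribs)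
qed

lemma fragment_defect_trig_poly:
  assumes "M' ** M = mat 1" "trig_poly f"
  shows "fragment_defect M M' f = 0"
  using assms(2)
proof induction
  case (wave m c)
  have "fragment_defect M M' (\<lambda>x. c * wave m x) = c * fragment_defect M M' (wave m)"
    by (simp add: fragment_defect_def ring_distribs sum_distrib_left mult_ac)
  then show ?case
    using fragment_wave_identity[OF assms(1), of m] wave by (simp add: fragment_defect_def)
next
  case (add f g)
  then show ?case
    by (simp add: fragment_defect_add continuous_on_trig_poly)
qed

lemma fragment_defect_of_real:
  "fragment_defect M M' (\<lambda>x. of_real (f x) :: complex) = of_real (fragment_defect M M' f)"
  by (simp add: fragment_defect_def set_integral_complex_of_real)

lemma fragment_defect_bound:
  fixes M M' :: "real ^ ('r::finite + 'k::finite) ^ ('r + 'k)" and f :: "real ^ ('r + 'k) \<Rightarrow> real"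
  assumes "continuous_on UNIV f" "\<And>x. \<bar>f x\<bar> \<le> e"
  shows "\<bar>fragment_defect M M' f\<bar> \<le>
    ((\<Sum>\<sigma> | card \<sigma> = CARD('r). \<bar>det (fragment \<sigma> M)\<bar>) + \<bar>det M\<bar>) * e"
proof -
  have "\<bar>det (fragment \<sigma> M) * (LINT x:unit_cube|lborel. f (M' *v (fragment \<sigma> M *v x)))\<bar> \<le>
      \<bar>det (fragment \<sigma> M)\<bar> * e" for \<sigma>
  proof -
    have "continuous_on UNIV (\<lambda>x. f (M' *v (fragment \<sigma> M *v x)))"
      by (rule continuous_on_compose2[OF assms(1)])
        (auto simp: matrix_vector_mul_assoc matrix_vector_mult_linear_continuous_on)
    then show ?thesis
      using assms(2) by (auto simp: abs_mult intro!: mult_left_mono set_integral_unit_cube_bound)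
  qed
  then have "\<bar>\<Sum>\<sigma> | card \<sigma> = CARD('r). det (fragment \<sigma> M) *
      (LINT x:unit_cube|lborel. f (M' *v (fragment \<sigma> M *v x)))\<bar> \<le>
      (\<Sum>\<sigma> | card \<sigma> = CARD('r). \<bar>det (fragment \<sigma> M)\<bar>) * e"
    unfolding sum_distrib_right by (intro order_trans[OF sum_abs] sum_mono)
  moreover have "\<bar>(-1) ^ CARD('k) * det M * (LINT x:unit_cube|lborel. f x)\<bar> \<le> \<bar>det M\<bar> * e"
    using set_integral_unit_cube_bound[OF assms]
    by (auto simp: abs_mult intro!: mult_left_mono)
  ultimately show ?thesis
    unfolding fragment_defect_def of_real_eq_id id_apply by (simp add: ring_distribs)
qed

text \<open>
  The defect is linear, bounded in the supremum norm, and zero on waves, hence zero on everything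
  that trigonometric polynomials approximate uniformly.
\<close>

lemma fragment_defect_torus:
  fixes M M' :: "real ^ ('r::finite + 'k::finite) ^ ('r + 'k)" and \<phi> :: "complex ^ ('r + 'k) \<Rightarrow> real"
  assumes inv: "M' ** M = mat 1" and \<phi>: "continuous_on UNIV \<phi>"
  shows "fragment_defect M M' (\<lambda>x. \<phi> (torus x)) = 0"
proof -
  define C where "C = (\<Sum>\<sigma> | card \<sigma> = CARD('r). \<bar>det (fragment \<sigma> M)\<bar>) + \<bar>det M\<bar>"
  let ?D = "fragment_defect M M'"
  have C: "C \<ge> 0" unfolding C_def by (intro add_nonneg_nonneg sum_nonneg) auto
  have small: "\<bar>?D (\<lambda>x. \<phi> (torus x))\<bar> \<le> C * e" if "e > 0" for e :: real
  proof -
    let ?R = "cball 0 (real CARD('r + 'k)) :: (complex ^ ('r + 'k)) set"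
    have torus: "torus x \<in> ?R" for x :: "real ^ ('r + 'k)"
    proof -
      have "norm (torus x) \<le> (\<Sum>i\<in>UNIV. norm (torus x $ i))"
        unfolding norm_vec_def by (rule L2_set_le_sum) simp
      also have "\<dots> = real CARD('r + 'k)"
        by (simp add: torus_def)
      finally show ?thesis by simp
    qed
    obtain g where g: "real_polynomial_function g" "\<And>\<zeta>. \<zeta> \<in> ?R \<Longrightarrow> \<bar>\<phi> \<zeta> - g \<zeta>\<bar> < e"
      using Stone_Weierstrass_real_polynomial_function[OF compact_cball continuous_on_subset[OF \<phi>] \<open>e > 0\<close>]
      by (metis subset_UNIV)
    have "continuous_on UNIV g"
      using continuous_on_polymonial_function g(1) real_polynomial_function_eq by blast
    then have cont: "continuous_on UNIV (\<lambda>x. \<phi> (torus x) - g (torus x))" "continuous_on UNIV (\<lambda>x. g (torus x))"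
      by (auto intro!: continuous_intros continuous_on_compose2[OF \<phi>] continuous_on_compose2[of UNIV g])
    have "complex_of_real (?D (\<lambda>x. g (torus x))) = 0"
      using fragment_defect_trig_poly[OF inv trig_poly_real_polynomial_torus[OF g(1)]]
      by (simp only: fragment_defect_of_real)
    then have "?D (\<lambda>x. \<phi> (torus x)) = ?D (\<lambda>x. \<phi> (torus x) - g (torus x))"
      using fragment_defect_add[OF cont, of M M'] by simp
    also have "\<bar>\<dots>\<bar> \<le> C * e"
      using g(2)[OF torus] unfolding C_def by (intro fragment_defect_bound cont) (simp add: less_imp_le)
    finally show ?thesis .
  qed
  show ?thesis
  proof (rule ccontr)
    let ?d = "\<bar>?D (\<lambda>x. \<phi> (torus x))\<bar>"
    assume "?D (\<lambda>x. \<phi> (torus x)) \<noteq> 0"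
    then have d: "?d > 0" by simp
    have "?d \<le> C * (?d / (C + 1))"
      by (intro small divide_pos_pos d add_nonneg_pos[OF C zero_less_one])
    also have "\<dots> < ?d"
      using C d by (simp add: field_simps)
    finally show False by simp
  qed
qed

section \<open>Bump functions that count lattice points\<close>

definition lattice_point :: "int ^ 'n::finite \<Rightarrow> real ^ 'n" where
  "lattice_point z = (\<chi> i. real_of_int (z $ i))"

lemma lattice_point_nth [simp]: "lattice_point z $ i = real_of_int (z $ i)"
  by (simp add: lattice_point_def)

lemma finite_lattice_translates_meeting_bounded:
  fixes S :: "(real ^ 'n::finite) set"
  assumes "bounded S"
  shows "finite {z. y - lattice_point z \<in> S}"
proof -
  obtain B where B: "\<And>x. x \<in> S \<Longrightarrow> norm x \<le> B"
    using assms unfolding bounded_iff by blast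
  let ?F = "\<lambda>i. {\<lceil>y $ i - B\<rceil>..\<lfloor>y $ i + B\<rfloor>}"
  have "vec_nth z \<in> PiE UNIV ?F" if "y - lattice_point z \<in> S" for z
  proof -
    have "\<bar>(y - lattice_point z) $ i\<bar> \<le> B" for i
      using B[OF that] component_le_norm_cart order_trans by blast
    then have "\<bar>y $ i - real_of_int (z $ i)\<bar> \<le> B" for i
      by simp
    then have "z $ i \<in> ?F i" for i
      unfolding atLeastAtMost_iff ceiling_le_iff le_floor_iff by (smt (verit))
    then show ?thesis by (blast intro: PiE_I)
  qed
  then have "{z. y - lattice_point z \<in> S} \<subseteq> vec_nth -` PiE UNIV ?F"
    by auto
  moreover have "finite (vec_nth -` PiE UNIV ?F :: (int ^ 'n) set)"
    by (intro finite_vimageI finite_PiE) (auto simp: inj_on_def vec_eq_iff)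
  ultimately show ?thesis by (rule finite_subset)
qed

lemma torus_minus_lattice_point: "torus (x - lattice_point z) = torus x"
proof -
  have "exp (2 * pi * \<i> * of_real (x $ i - of_int (z $ i))) = exp (2 * pi * \<i> * of_real (x $ i))" for i
  proof -
    have "2 * pi * \<i> * of_real (x $ i) =
        2 * pi * \<i> * of_real (x $ i - of_int (z $ i)) + 2 * of_int (z $ i) * pi * \<i>"
      by (simp add: algebra_simps)
    moreover have "exp (2 * of_int (z $ i) * pi * \<i>) = 1"
      by (rule exp_integer_2pi) simp
    ultimately show ?thesis
      by (simp only: exp_add mult_1_right)
  qed
  then show ?thesis
    by (simp add: torus_def vec_eq_iff)
qed

text \<open>
  Two points of the unit circle whose angles differ by \<open>2 * pi * u\<close> have distance \<open>2 * \<bar>sin (pi * u)\<bar>\<close>, and sine is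
  increasing up to \<open>pi / 2\<close>. The division by the dimension allows for the comparison of the
  norm with the sum of the coordinates.
\<close>

lemma near_lattice_if_torus_close:
  fixes x y :: "real ^ 'n::finite"
  assumes \<eta>: "0 < \<eta>" "\<eta> \<le> 1/2"
    and close: "norm (torus x - torus y) < 2 * sin (pi * (\<eta> / CARD('n)))"
  obtains z where "x \<in> ball (y - lattice_point z) \<eta>"
proof -
  define \<epsilon> where "\<epsilon> = \<eta> / CARD('n)"
  have card: "real CARD('n) \<ge> 1"
    by (simp add: Suc_le_eq)
  have \<epsilon>: "0 < \<epsilon>" "\<epsilon> \<le> 1/2"
    using \<eta> card by (auto simp: \<epsilon>_def field_simps intro: order_trans)
  define z :: "int ^ 'n" where "z = (\<chi> i. - round (x $ i - y $ i))"
  define u where "u = x - (y - lattice_point z)"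
  have u: "\<bar>u $ i\<bar> < \<epsilon>" for i
  proof (rule ccontr)
    assume neg: "\<not> \<bar>u $ i\<bar> < \<epsilon>"
    have half: "\<bar>u $ i\<bar> \<le> 1/2"
      using of_int_round_abs_le[of "x $ i - y $ i"] by (simp add: u_def z_def algebra_simps abs_minus_commute)
    have "torus x $ i - torus y $ i = torus (y + u) $ i - torus y $ i"
      using torus_minus_lattice_point[of "y + u" z] by (simp add: u_def)
    also have "\<dots> = torus y $ i * (exp (\<i> * of_real (2 * pi * u $ i)) - 1)"
      by (simp add: torus_def exp_add[symmetric] algebra_simps)
    finally have chord: "norm (torus x $ i - torus y $ i) = 2 * \<bar>sin (pi * u $ i)\<bar>"
      using dist_exp_i_1[of "2 * pi * u $ i"] by (simp add: norm_mult torus_def)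
    have abs_sin: "\<bar>sin (pi * u $ i)\<bar> = sin (pi * \<bar>u $ i\<bar>)"
    proof -
      have "sin (pi * \<bar>u $ i\<bar>) \<ge> 0"
        using half by (intro sin_ge_zero) (auto intro: mult_left_le)
      then show ?thesis by (cases "u $ i \<ge> 0") (auto simp: abs_if)
    qed
    have "sin (pi * \<epsilon>) \<le> sin (pi * \<bar>u $ i\<bar>)"
      using neg half \<epsilon> by (intro sin_monotone_2pi_le) (auto simp: mult_le_cancel_left_pos intro: order_trans[of _ 0])
    then have "2 * sin (pi * \<epsilon>) \<le> norm (torus x $ i - torus y $ i)"
      unfolding chord abs_sin by simp
    also have "\<dots> \<le> norm (torus x - torus y)"
      using Finite_Cartesian_Product.norm_nth_le[of "torus x - torus y" i] by simp
    finally show False using close by (simp add: \<epsilon>_def)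
  qed
  have "norm u \<le> (\<Sum>i\<in>UNIV. \<bar>u $ i\<bar>)"
    by (rule norm_le_l1_cart)
  also have "\<dots> < (\<Sum>i\<in>(UNIV :: 'n set). \<epsilon>)"
    using u by (intro sum_strict_mono) auto
  also have "\<dots> = \<eta>"
    using card by (simp add: \<epsilon>_def)
  finally have "x \<in> ball (y - lattice_point z) \<eta>"
    by (simp add: dist_norm u_def norm_minus_commute)
  then show thesis by (rule that)
qed

lemma ball_lattice_translates_disjoint:
  fixes y :: "real ^ 'n::finite"
  assumes "x \<in> ball (y - lattice_point z) (1/2)" "x \<in> ball (y - lattice_point z') (1/2)"
  shows "z = z'"
proof -
  have "dist (y - lattice_point z) (y - lattice_point z') < 1"
    using dist_triangle_half_l[of "y - lattice_point z" x 1 "y - lattice_point z'"] assms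
    by (simp add: dist_commute)
  then have "norm (lattice_point z' - lattice_point z) < 1"
    by (simp add: dist_norm)
  then have "\<bar>(lattice_point z' - lattice_point z) $ i\<bar> < 1" for i
    using component_le_norm_cart le_less_trans by blast
  then have "\<bar>z' $ i - z $ i\<bar> < 1" for i
    by (simp flip: of_int_diff of_int_abs)
  then show ?thesis
    by (auto simp: vec_eq_iff)
qed

lemma integral_lborel_translate:
  fixes f :: "'a::euclidean_space \<Rightarrow> real"
  assumes [measurable]: "f \<in> borel_measurable borel"
  shows "(\<integral>x. f (c + x) \<partial>lborel) = (\<integral>x. f x \<partial>lborel)"
  by (subst (2) lborel_distr_plus[of c, symmetric]) (simp add: integral_distr)

text \<open>
  This turns an integral into a count: after the substitution \<open>u = N *v x\<close> the integrand lives on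
  disjoint lattice translates of one ball, each of which lies in the parallelepiped or misses it, and
  each of the former contributes the same amount by periodicity.
\<close>

lemma integral_matrix_periodic_bump:
  fixes N :: "real ^ 'n::finite ^ 'n" and \<psi> :: "real ^ 'n \<Rightarrow> real"
  assumes N: "det N \<noteq> 0" and cont: "continuous_on UNIV \<psi>"
    and periodic: "\<And>x z. \<psi> (x - lattice_point z) = \<psi> x"
    and supp: "\<And>x. \<psi> x \<noteq> 0 \<Longrightarrow> \<exists>z. x \<in> ball (y - lattice_point z) \<eta>"
    and \<eta>: "0 < \<eta>" "\<eta> \<le> 1/2"
    and decided: "\<And>z. ball (y - lattice_point z) \<eta> \<subseteq> (*v) N ` unit_cube \<or>
                      ball (y - lattice_point z) \<eta> \<inter> (*v) N ` unit_cube = {}"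
  shows "\<bar>det N\<bar> * (LINT x:unit_cube|lborel. \<psi> (N *v x)) =
         card {z. y - lattice_point z \<in> (*v) N ` unit_cube} * (LINT x:ball y \<eta>|lborel. \<psi> x)"
proof -
  define K where "K = (*v) N ` unit_cube"
  define Z where "Z = {z. y - lattice_point z \<in> K}"
  have "compact K"
    unfolding K_def by (intro compact_continuous_image continuous_intros compact_cbox)
  then have [measurable]: "K \<in> sets borel" and "bounded K"
    by (auto intro: compact_imp_bounded borel_compact)
  then have "finite Z"
    by (simp add: Z_def finite_lattice_translates_meeting_bounded)
  have psi_meas [measurable]: "\<psi> \<in> borel_measurable borel"
    using cont by (rule borel_measurable_continuous_onI)
  have inK: "N *v x \<in> K \<longleftrightarrow> x \<in> unit_cube" for x
    using N inj_matrix_vector_mult[of N] invertible_det_nz[of N]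
    by (auto simp: K_def inj_image_mem_iff)
  have pointwise: "indicator K u *\<^sub>R \<psi> u = (\<Sum>z\<in>Z. indicator (ball (y - lattice_point z) \<eta>) u *\<^sub>R \<psi> u)" for u
  proof (cases "\<psi> u = 0")
    case False
    then obtain z0 where z0: "u \<in> ball (y - lattice_point z0) \<eta>"
      using supp by blast
    have only: "u \<in> ball (y - lattice_point z) \<eta> \<longleftrightarrow> z = z0" for z
      using z0 \<eta>(2) ball_lattice_translates_disjoint[of u y z z0] subset_ball[OF \<eta>(2)] by blast
    have centre: "y - lattice_point z0 \<in> ball (y - lattice_point z0) \<eta>"
      using \<eta> by simp
    have "u \<in> K \<longleftrightarrow> z0 \<in> Z"
      using decided[of z0] z0 centre unfolding K_def[symmetric] Z_def by blast
    moreover have "(\<Sum>z\<in>Z. indicator (ball (y - lattice_point z) \<eta>) u *\<^sub>R \<psi> u) =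
        (\<Sum>z\<in>Z. if z = z0 then \<psi> u else 0)"
      by (intro sum.cong refl) (simp add: only indicator_def del: mem_ball)
    ultimately show ?thesis
      using \<open>finite Z\<close> by (simp add: sum.delta' indicator_def)
  qed simp
  have int: "integrable lborel (\<lambda>u. indicator (ball c \<eta>) u *\<^sub>R \<psi> u)" for c
  proof -
    have "set_integrable lborel (cball c \<eta>) \<psi>"
      unfolding set_integrable_def
      by (intro borel_integrable_compact) (auto intro: continuous_on_subset[OF cont])
    then have "set_integrable lborel (ball c \<eta>) \<psi>"
      by (rule set_integrable_subset) auto
    then show ?thesis by (simp add: set_integrable_def)
  qed
  have "\<bar>det N\<bar> * (LINT x:unit_cube|lborel. \<psi> (N *v x)) = (\<integral>u. indicator K u *\<^sub>R \<psi> u \<partial>lborel)"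
    unfolding set_lebesgue_integral_def
    by (subst integral_lborel_matrix[OF N]) (simp_all add: inK indicator_def)
  also have "\<dots> = (\<Sum>z\<in>Z. \<integral>u. indicator (ball (y - lattice_point z) \<eta>) u *\<^sub>R \<psi> u \<partial>lborel)"
    unfolding pointwise by (intro Bochner_Integration.integral_sum int)
  also have "\<dots> = (\<Sum>z\<in>Z. LINT x:ball y \<eta>|lborel. \<psi> x)"
  proof (intro sum.cong refl)
    fix z
    have "(\<integral>u. indicator (ball (y - lattice_point z) \<eta>) u *\<^sub>R \<psi> u \<partial>lborel) =
        (\<integral>u. indicator (ball (y - lattice_point z) \<eta>) (- lattice_point z + u) *\<^sub>R \<psi> (- lattice_point z + u) \<partial>lborel)"
      by (rule integral_lborel_translate[symmetric])
        (simp add: borel_measurable_scaleR borel_measurable_indicator psi_meas del: real_scaleR_def)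
    also have "\<dots> = (LINT x:ball y \<eta>|lborel. \<psi> x)"
      using periodic by (simp add: set_lebesgue_integral_def indicator_def dist_norm algebra_simps)
    finally show "(\<integral>u. indicator (ball (y - lattice_point z) \<eta>) u *\<^sub>R \<psi> u \<partial>lborel) = (LINT x:ball y \<eta>|lborel. \<psi> x)" .
  qed
  finally show ?thesis
    by (simp add: Z_def K_def)
qed

lemma set_integral_ball_pos:
  fixes \<psi> :: "'a::euclidean_space \<Rightarrow> real"
  assumes cont: "continuous_on UNIV \<psi>" and nonneg: "\<And>x. \<psi> x \<ge> 0" and pos: "\<psi> y > 0" and \<eta>: "\<eta> > 0"
  shows "(LINT x:ball y \<eta>|lborel. \<psi> x) > 0"
proof -
  have "open {x. \<psi> x > \<psi> y / 2}"
    using cont by (intro open_Collect_less continuous_intros)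
  then obtain r where r: "r > 0" "ball y r \<subseteq> {x. \<psi> x > \<psi> y / 2}"
    using pos by (metis (mono_tags, lifting) field_sum_of_halves less_add_same_cancel1 half_gt_zero mem_Collect_eq open_contains_ball)
  define s where "s = min r \<eta>"
  have int: "set_integrable lborel (ball y \<eta>) \<psi>"
  proof (rule set_integrable_subset)
    show "set_integrable lborel (cball y \<eta>) \<psi>"
      unfolding set_integrable_def
      by (intro borel_integrable_compact) (auto intro: continuous_on_subset[OF cont])
  qed auto
  have "0 < measure lborel (ball y s) * (\<psi> y / 2)"
    using pos r \<eta> by (auto simp: s_def content_ball_pos)
  also have "\<dots> = (\<integral>x. indicator (ball y s) x *\<^sub>R (\<psi> y / 2) \<partial>lborel)"
    by simp
  also have "\<dots> \<le> (LINT x:ball y \<eta>|lborel. \<psi> x)"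
    unfolding set_lebesgue_integral_def
  proof (rule integral_mono)
    show "integrable lborel (\<lambda>x. indicator (ball y s) x *\<^sub>R (\<psi> y / 2))"
      by (intro integrable_scaleR_left integrable_real_indicator) (simp_all add: emeasure_bounded_finite[unfolded infinity_ennreal_def])
    show "integrable lborel (\<lambda>x. indicator (ball y \<eta>) x *\<^sub>R \<psi> x)"
      using int by (simp add: set_integrable_def)
    fix x
    show "indicator (ball y s) x *\<^sub>R (\<psi> y / 2) \<le> indicator (ball y \<eta>) x *\<^sub>R \<psi> x"
      using r nonneg[of x] by (auto simp: indicator_def s_def subset_iff)
  qed
  finally show ?thesis .
qed

section \<open>Moving a point off the walls\<close>

lemma eventually_sign_affine:
  fixes a b :: real
  assumes "b \<noteq> 0"
  shows "(\<forall>\<^sub>F \<epsilon> in at_right 0. a + \<epsilon> * b > 0) \<or> (\<forall>\<^sub>F \<epsilon> in at_right 0. a + \<epsilon> * b < 0)"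
proof -
  have lim: "((\<lambda>\<epsilon>. a + \<epsilon> * b) \<longlongrightarrow> a) (at_right 0)"
    by (auto intro!: tendsto_eq_intros)
  have pos: "\<forall>\<^sub>F \<epsilon> in at_right (0::real). \<epsilon> > 0"
    by (simp add: eventually_at_right_less)
  consider "a > 0" | "a < 0" | "a = 0" "b > 0" | "a = 0" "b < 0"
    using assms by linarith
  then show ?thesis
  proof cases
    case 1 then show ?thesis using order_tendstoD(1)[OF lim] by blast
  next
    case 2 then show ?thesis using order_tendstoD(2)[OF lim] by blast
  next
    case 3 then show ?thesis using pos by (auto elim: eventually_mono)
  next
    case 4
    have "\<forall>\<^sub>F \<epsilon> in at_right 0. a + \<epsilon> * b < 0"
      using pos by (rule eventually_mono) (use 4 in \<open>simp add: mult_pos_neg\<close>)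
    then show ?thesis ..
  qed
qed

text \<open>
  In the coordinates of the parallelepiped the point moves on a ray that is parallel to no facet,
  as all coordinates of \<open>b\<close> are nonzero, so it leaves each facet hyperplane at once.
\<close>

lemma eventually_inside_or_outside:
  fixes N :: "real ^ 'n::finite ^ 'n"
  assumes N: "det N \<noteq> 0" and b: "\<And>i. b $ i \<noteq> 0"
  shows "(\<forall>\<^sub>F \<epsilon> in at_right 0. q + \<epsilon> *\<^sub>R (N *v b) \<in> interior ((*v) N ` unit_cube)) \<or>
         (\<forall>\<^sub>F \<epsilon> in at_right 0. q + \<epsilon> *\<^sub>R (N *v b) \<notin> (*v) N ` unit_cube)"
proof -
  obtain N' where N': "N ** N' = mat 1" "N' ** N = mat 1"
    using N invertible_det_nz invertible_def by metis
  define a where "a = N' *v q"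
  have q: "q + \<epsilon> *\<^sub>R (N *v b) = N *v (a + \<epsilon> *\<^sub>R b)" for \<epsilon>
    by (simp add: a_def matrix_vector_right_distrib matrix_vector_mult_scaleR matrix_vector_mul_assoc N')
  have inj: "inj ((*v) N)"
    using N inj_matrix_vector_mult invertible_det_nz by blast
  have mem: "q + \<epsilon> *\<^sub>R (N *v b) \<in> (*v) N ` S \<longleftrightarrow> a + \<epsilon> *\<^sub>R b \<in> S" for \<epsilon> S
    unfolding q by (rule inj_image_mem_iff[OF inj])
  have "open ((*v) N ` box 0 1)"
    using inj by (intro open_surjective_linear_image open_box linear_injective_imp_surjective) auto
  then have interior: "(*v) N ` box 0 1 \<subseteq> interior ((*v) N ` unit_cube)"
    by (intro interior_maximal image_mono box_subset_cbox)
  have lt1: "(a $ i - 1) + \<epsilon> * b $ i < 0 \<longleftrightarrow> a $ i + \<epsilon> * b $ i < 1" for \<epsilon> i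
    by linarith
  show ?thesis
  proof (cases "\<forall>i. (\<forall>\<^sub>F \<epsilon> in at_right 0. a $ i + \<epsilon> * b $ i > 0) \<and>
                     (\<forall>\<^sub>F \<epsilon> in at_right 0. (a $ i - 1) + \<epsilon> * b $ i < 0)")
    case True
    then have "\<forall>\<^sub>F \<epsilon> in at_right 0. \<forall>i. a $ i + \<epsilon> * b $ i > 0 \<and> (a $ i - 1) + \<epsilon> * b $ i < 0"
      by (intro eventually_all_finite eventually_conj) auto
    then have "\<forall>\<^sub>F \<epsilon> in at_right 0. a + \<epsilon> *\<^sub>R b \<in> box 0 1"
      by (rule eventually_mono) (simp add: mem_box_cart lt1)
    then have "\<forall>\<^sub>F \<epsilon> in at_right 0. q + \<epsilon> *\<^sub>R (N *v b) \<in> (*v) N ` box 0 1"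
      by (simp add: mem)
    then have "\<forall>\<^sub>F \<epsilon> in at_right 0. q + \<epsilon> *\<^sub>R (N *v b) \<in> interior ((*v) N ` unit_cube)"
      by (rule eventually_mono) (use interior in blast)
    then show ?thesis ..
  next
    case False
    then obtain i where "(\<forall>\<^sub>F \<epsilon> in at_right 0. a $ i + \<epsilon> * b $ i < 0) \<or>
        (\<forall>\<^sub>F \<epsilon> in at_right 0. (a $ i - 1) + \<epsilon> * b $ i > 0)"
      using eventually_sign_affine[OF b] by blast
    then have "\<forall>\<^sub>F \<epsilon> in at_right 0. a $ i + \<epsilon> * b $ i < 0 \<or> a $ i + \<epsilon> * b $ i > 1"
      by (auto elim!: eventually_mono)
    then have "\<forall>\<^sub>F \<epsilon> in at_right 0. a + \<epsilon> *\<^sub>R b \<notin> unit_cube"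
      by (rule eventually_mono) (auto simp: mem_box_cart intro!: exI[of _ i])
    then show ?thesis by (simp add: mem)
  qed
qed

lemma eventually_small_at_right: "0 < c \<Longrightarrow> \<forall>\<^sub>F \<epsilon> in at_right 0. 0 < \<epsilon> \<and> \<epsilon> < (c::real)"
  unfolding eventually_at_right_field by blast

lemma not_eventually_and_eventually_not:
  "(\<forall>\<^sub>F \<epsilon> in at_right (0::real). P \<epsilon>) \<Longrightarrow> (\<forall>\<^sub>F \<epsilon> in at_right 0. \<not> P \<epsilon>) \<Longrightarrow> False"
  using eventually_conj eventually_happens'[OF trivial_limit_at_right_real] by fastforce

text \<open>
  One bound on \<open>\<epsilon>\<close> serves all lattice points, because only finitely many translates
  come near the bounded set \<open>K\<close>.
\<close>

lemma eventually_all_translates_inside_or_outside: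
  fixes K :: "(real ^ 'n::finite) set"
  assumes "bounded K"
    and dich: "\<And>z. (\<forall>\<^sub>F \<epsilon> in at_right 0. y - lattice_point z + \<epsilon> *\<^sub>R v \<in> interior K) \<or>
                   (\<forall>\<^sub>F \<epsilon> in at_right 0. y - lattice_point z + \<epsilon> *\<^sub>R v \<notin> K)"
  shows "\<forall>\<^sub>F \<epsilon> in at_right 0. \<forall>z.
    if \<forall>\<^sub>F \<epsilon> in at_right 0. y - lattice_point z + \<epsilon> *\<^sub>R v \<in> K
    then y + \<epsilon> *\<^sub>R v - lattice_point z \<in> interior K else y + \<epsilon> *\<^sub>R v - lattice_point z \<notin> K"
    (is "\<forall>\<^sub>F \<epsilon> in _. \<forall>z. ?P \<epsilon> z")
proof -
  obtain B where B: "\<And>x. x \<in> K \<Longrightarrow> norm x \<le> B"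
    using assms(1) unfolding bounded_iff by blast
  define Z where "Z = {z. y - lattice_point z \<in> cball 0 (B + norm v)}"
  have "finite Z"
    unfolding Z_def by (intro finite_lattice_translates_meeting_bounded bounded_cball)
  have comm: "y + \<epsilon> *\<^sub>R v - lattice_point z = y - lattice_point z + \<epsilon> *\<^sub>R v" for \<epsilon> z
    by simp
  have near: "z \<in> Z" if "y - lattice_point z + \<epsilon> *\<^sub>R v \<in> K" "0 < \<epsilon>" "\<epsilon> < 1" for z \<epsilon>
  proof -
    have "norm (y - lattice_point z) \<le> norm (y - lattice_point z + \<epsilon> *\<^sub>R v) + norm (\<epsilon> *\<^sub>R v)"
      using norm_triangle_ineq4[of "y - lattice_point z + \<epsilon> *\<^sub>R v" "\<epsilon> *\<^sub>R v"] by simp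
    also have "\<dots> \<le> B + norm v"
      using B[OF that(1)] that by (intro add_mono) (auto intro: mult_left_le_one_le)
    finally show ?thesis by (simp add: Z_def)
  qed
  have small: "\<forall>\<^sub>F \<epsilon> in at_right 0. 0 < \<epsilon> \<and> \<epsilon> < (1::real)"
    by (rule eventually_small_at_right) simp
  have each: "\<forall>\<^sub>F \<epsilon> in at_right 0. ?P \<epsilon> z" for z
  proof (cases "\<forall>\<^sub>F \<epsilon> in at_right 0. y - lattice_point z + \<epsilon> *\<^sub>R v \<in> K")
    case True
    then have "\<not> (\<forall>\<^sub>F \<epsilon> in at_right 0. y - lattice_point z + \<epsilon> *\<^sub>R v \<notin> K)"
      using True not_eventually_and_eventually_not by blast
    with dich[of z] True show ?thesis
      unfolding comm by simp
  next
    case False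
    have "\<not> (\<forall>\<^sub>F \<epsilon> in at_right 0. y - lattice_point z + \<epsilon> *\<^sub>R v \<in> interior K)"
    proof
      assume "\<forall>\<^sub>F \<epsilon> in at_right 0. y - lattice_point z + \<epsilon> *\<^sub>R v \<in> interior K"
      then have "\<forall>\<^sub>F \<epsilon> in at_right 0. y - lattice_point z + \<epsilon> *\<^sub>R v \<in> K"
        by (rule eventually_mono) (use interior_subset in blast)
      with False show False by simp
    qed
    with dich[of z] False show ?thesis
      unfolding comm by simp
  qed
  have "\<forall>\<^sub>F \<epsilon> in at_right 0. \<forall>z\<in>Z. ?P \<epsilon> z"
    using \<open>finite Z\<close> each by (intro eventually_ball_finite) auto
  with small show ?thesis
  proof eventually_elim
    case (elim \<epsilon>)
    have "?P \<epsilon> z" if "z \<notin> Z" for z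
    proof -
      have out: "\<forall>\<^sub>F \<epsilon> in at_right 0. y - lattice_point z + \<epsilon> *\<^sub>R v \<notin> K"
        using small by (rule eventually_mono) (use near that in blast)
      have "\<not> (\<forall>\<^sub>F \<epsilon> in at_right 0. y - lattice_point z + \<epsilon> *\<^sub>R v \<in> K)"
        using out not_eventually_and_eventually_not by blast
      moreover have "y - lattice_point z + \<epsilon> *\<^sub>R v \<notin> K"
        using near that elim by blast
      ultimately show ?thesis unfolding comm by simp
    qed
    with elim show ?case by blast
  qed
qed

lemma eventually_balls_decided:
  fixes K :: "(real ^ 'n::finite) set"
  assumes K: "compact K" and dec: "\<And>z. y - lattice_point z \<in> interior K \<or> y - lattice_point z \<notin> K"
  shows "\<forall>\<^sub>F \<eta> in at_right 0. \<forall>z. ball (y - lattice_point z) \<eta> \<subseteq> K \<or> ball (y - lattice_point z) \<eta> \<inter> K = {}"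
    (is "\<forall>\<^sub>F \<eta> in _. \<forall>z. ?P \<eta> z")
proof -
  obtain B where B: "\<And>x. x \<in> K \<Longrightarrow> norm x \<le> B"
    using compact_imp_bounded[OF K] unfolding bounded_iff by blast
  define Z where "Z = {z. y - lattice_point z \<in> cball 0 (B + 1)}"
  have "finite Z"
    unfolding Z_def by (intro finite_lattice_translates_meeting_bounded bounded_cball)
  have small: "\<forall>\<^sub>F \<eta> in at_right 0. 0 < \<eta> \<and> \<eta> < (1::real)"
    by (rule eventually_small_at_right) simp
  have "\<forall>\<^sub>F \<eta> in at_right 0. ?P \<eta> z" for z
  proof -
    have "\<exists>r>0. ball (y - lattice_point z) r \<subseteq> K \<or> ball (y - lattice_point z) r \<subseteq> - K"
    proof (cases "y - lattice_point z \<in> K")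
      case True
      then show ?thesis using dec[of z] mem_interior by blast
    next
      case False
      moreover have "open (- K)" using K by (simp add: compact_imp_closed open_Compl)
      ultimately show ?thesis using open_contains_ball by blast
    qed
    then obtain r where r: "r > 0"
      "ball (y - lattice_point z) r \<subseteq> K \<or> ball (y - lattice_point z) r \<subseteq> - K" by blast
    have "?P \<eta> z" if "\<eta> < r" for \<eta>
      using r(2) subset_ball[of \<eta> r "y - lattice_point z"] that by fastforce
    then show ?thesis
      by (rule eventually_mono[OF eventually_small_at_right[OF r(1)] _]) simp
  qed
  then have "\<forall>\<^sub>F \<eta> in at_right 0. \<forall>z\<in>Z. ?P \<eta> z"
    using \<open>finite Z\<close> by (intro eventually_ball_finite) auto
  with small show ?thesis
  proof eventually_elim
    case (elim \<eta>)
    have "ball (y - lattice_point z) \<eta> \<inter> K = {}" if "z \<notin> Z" for z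
    proof -
      have "norm (y - lattice_point z) \<le> B + 1" if x: "x \<in> K" "dist (y - lattice_point z) x < \<eta>" for x
      proof -
        have "norm (y - lattice_point z) \<le> norm x + dist (y - lattice_point z) x"
          using norm_triangle_ineq[of x "y - lattice_point z - x"] by (simp add: dist_norm)
        then show ?thesis using B[OF x(1)] x(2) elim by linarith
      qed
      then show ?thesis using that by (auto simp: Z_def)
    qed
    with elim show ?case by blast
  qed
qed

section \<open>Tiles in lattice coordinates\<close>

lemma closed_parallelepiped_eq_image:
  fixes N :: "real ^ 'n::finite ^ 'n"
  shows "closed_parallelepiped N = (*v) N ` unit_cube"
proof (intro equalityI subsetI)
  fix p assume "p \<in> closed_parallelepiped N"
  then obtain x where x: "\<And>i. 0 \<le> x i \<and> x i \<le> (1::real)" "p = (\<Sum>i\<in>UNIV. x i *\<^sub>R column i N)"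
    unfolding closed_parallelepiped_def by blast
  then have "p = N *v vec_lambda x" "vec_lambda x \<in> unit_cube"
    by (auto simp: matrix_mult_sum scalar_mult_eq_scaleR mem_box_cart)
  then show "p \<in> (*v) N ` unit_cube" by blast
qed (auto simp: closed_parallelepiped_def matrix_mult_sum scalar_mult_eq_scaleR mem_box_cart)

text \<open>
  If a coordinate of \<open>b\<close> vanished, \<open>N *v b\<close> would be a combination of the other columns.
\<close>

lemma generic_coordinates_nonzero:
  fixes N :: "real ^ 'n::finite ^ 'n"
  assumes "\<And>J. card J = CARD('n) - 1 \<Longrightarrow> N *v b \<notin> span ((\<lambda>i. column i N) ` J)"
  shows "b $ i \<noteq> 0"
proof
  assume "b $ i = 0"
  then have "N *v b = (\<Sum>j\<in>UNIV - {i}. b $ j *\<^sub>R column j N)"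
    by (simp add: matrix_mult_sum scalar_mult_eq_scaleR sum.remove[of UNIV i])
  also have "\<dots> \<in> span ((\<lambda>i. column i N) ` (UNIV - {i}))"
    by (intro span_sum span_scale span_base) auto
  finally show False
    using assms[of "UNIV - {i}"] by simp
qed

text \<open>
  Applying \<open>M'\<close>, the inverse of \<open>M\<close>, turns the translations by \<open>M *v lattice_point z\<close> into
  translations by integer vectors.
\<close>

lemma tile_iff:
  assumes inv: "M ** M' = mat 1" "M' ** M = mat 1"
  shows "p \<in> tile w M (z, \<sigma>) \<longleftrightarrow>
    (\<forall>\<^sub>F \<epsilon> in at_right 0.
       M' *v p - lattice_point z + \<epsilon> *\<^sub>R (M' *v w) \<in> (*v) (M' ** fragment \<sigma> M) ` unit_cube)"
proof -
  have "p \<in> tile w M (z, \<sigma>) \<longleftrightarrow> p - M *v lattice_point z \<in> half_open_parallelepiped w (fragment \<sigma> M)"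
    unfolding tile_def lattice_point_def prod.case image_iff by (metis add_diff_cancel diff_add_cancel)
  moreover have "p - M *v lattice_point z + \<epsilon> *\<^sub>R w \<in> (*v) (fragment \<sigma> M) ` unit_cube \<longleftrightarrow>
      M' *v p - lattice_point z + \<epsilon> *\<^sub>R (M' *v w) \<in> (*v) (M' ** fragment \<sigma> M) ` unit_cube" for \<epsilon>
  proof -
    have "inj ((*v) M')"
      using inv by (metis inj_matrix_vector_mult invertible_def)
    moreover have "M' *v (p - M *v lattice_point z + \<epsilon> *\<^sub>R w) = M' *v p - lattice_point z + \<epsilon> *\<^sub>R (M' *v w)"
      by (simp add: matrix_vector_right_distrib matrix_vector_mult_diff_distrib matrix_vector_mult_scaleR
          matrix_vector_mul_assoc inv)
    moreover have "(*v) (M' ** fragment \<sigma> M) ` unit_cube = (*v) M' ` (*v) (fragment \<sigma> M) ` unit_cube"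
      by (simp add: image_image matrix_vector_mul_assoc)
    ultimately show ?thesis
      by (metis inj_image_mem_iff)
  qed
  ultimately show ?thesis
    by (simp add: half_open_parallelepiped_def closed_parallelepiped_eq_image)
qed

lemma finite_translates_containing:
  assumes "invertible M"
  shows "finite {z. p \<in> tile w M (z, \<sigma>)}"
proof -
  obtain M' where inv: "M ** M' = mat 1" "M' ** M = mat 1"
    using assms invertible_def by blast
  let ?K = "(*v) (M' ** fragment \<sigma> M) ` unit_cube"
  have "bounded ?K"
    by (intro bounded_linear_image bounded_cbox) (simp add: linear_conv_bounded_linear[symmetric])
  then obtain B where B: "\<And>x. x \<in> ?K \<Longrightarrow> norm x \<le> B"
    unfolding bounded_iff by blast
  have "M' *v p - lattice_point z \<in> cball 0 (B + norm (M' *v w))" if "p \<in> tile w M (z, \<sigma>)" for z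
  proof -
    have "\<forall>\<^sub>F \<epsilon> in at_right (0::real). 0 < \<epsilon> \<and> \<epsilon> < 1"
      by (rule eventually_small_at_right) simp
    then have "\<forall>\<^sub>F \<epsilon> in at_right (0::real). (0 < \<epsilon> \<and> \<epsilon> < 1) \<and>
        M' *v p - lattice_point z + \<epsilon> *\<^sub>R (M' *v w) \<in> ?K"
      using that unfolding tile_iff[OF inv] by (rule eventually_conj)
    then obtain \<epsilon> :: real where \<epsilon>: "0 < \<epsilon>" "\<epsilon> < 1"
        "M' *v p - lattice_point z + \<epsilon> *\<^sub>R (M' *v w) \<in> ?K"
      using eventually_happens'[OF trivial_limit_at_right_real] by blast
    have "norm (M' *v p - lattice_point z) \<le>
        norm (M' *v p - lattice_point z + \<epsilon> *\<^sub>R (M' *v w)) + norm (\<epsilon> *\<^sub>R (M' *v w))"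
      using norm_triangle_ineq4[of "M' *v p - lattice_point z + \<epsilon> *\<^sub>R (M' *v w)" "\<epsilon> *\<^sub>R (M' *v w)"] by simp
    also have "\<dots> \<le> B + norm (M' *v w)"
      using B[OF \<epsilon>(3)] \<epsilon> by (intro add_mono) (auto intro: mult_left_le_one_le)
    finally show ?thesis by simp
  qed
  then have "{z. p \<in> tile w M (z, \<sigma>)} \<subseteq> {z. M' *v p - lattice_point z \<in> cball 0 (B + norm (M' *v w))}"
    by blast
  then show ?thesis
    by (rule finite_subset) (intro finite_lattice_translates_meeting_bounded bounded_cball)
qed

lemma signed_count_eq_sum:
  fixes M :: "real ^ ('r::finite + 'k::finite) ^ ('r + 'k)"
  assumes "invertible M"
  shows "signed_count w M p =
    (\<Sum>\<sigma> | card \<sigma> = CARD('r). sgn (det (fragment \<sigma> M)) * card {z. p \<in> tile w M (z, \<sigma>)})"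
proof -
  define Z where "Z \<sigma> = {z. p \<in> tile w M (z, \<sigma>)}" for \<sigma>
  have fin: "finite (Z \<sigma>)" for \<sigma>
    unfolding Z_def by (rule finite_translates_containing[OF assms])
  have count: "(\<Sum>\<^sub>\<infinity>t\<in>{(z, \<sigma>). card \<sigma> = CARD('r) \<and> Q (det (fragment \<sigma> M))}. indicator (tile w M t) p :: int) =
      (\<Sum>\<sigma> | card \<sigma> = CARD('r). of_bool (Q (det (fragment \<sigma> M))) * int (card (Z \<sigma>)))" for Q
  proof -
    let ?S = "{\<sigma>. card \<sigma> = CARD('r) \<and> Q (det (fragment \<sigma> M))}"
    have "(\<Sum>\<^sub>\<infinity>t\<in>{(z, \<sigma>). card \<sigma> = CARD('r) \<and> Q (det (fragment \<sigma> M))}. indicator (tile w M t) p :: int) =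
        (\<Sum>\<^sub>\<infinity>t\<in>prod.swap ` Sigma ?S Z. 1)"
      by (rule infsum_cong_neutral) (auto simp: Z_def indicator_def image_iff)
    also have "\<dots> = int (card (Sigma ?S Z))"
      using fin by (simp add: card_image)
    also have "\<dots> = (\<Sum>\<sigma>\<in>?S. int (card (Z \<sigma>)))"
      using fin by simp
    also have "\<dots> = (\<Sum>\<sigma> | card \<sigma> = CARD('r). of_bool (Q (det (fragment \<sigma> M))) * int (card (Z \<sigma>)))"
      by (intro sum.mono_neutral_cong_left) auto
    finally show ?thesis .
  qed
  have "signed_count w M p =
      (\<Sum>\<sigma> | card \<sigma> = CARD('r).
        (of_bool (det (fragment \<sigma> M) > 0) - of_bool (det (fragment \<sigma> M) < 0)) * int (card (Z \<sigma>)))"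
    unfolding signed_count_def pos_tiles_def neg_tiles_def
    using count[of "\<lambda>d. d > 0"] count[of "\<lambda>d. d < 0"]
    by (simp add: sum_subtractf left_diff_distrib)
  then show ?thesis
    by (auto simp: Z_def sgn_real_def intro!: sum.cong)
qed

text \<open>
  The unit cube is itself a tile of the integer lattice, and a point off its walls lies in exactly one
  translate: this normalises the count.
\<close>

lemma card_integer_translates_in_unit_cube:
  assumes "\<And>z. y - lattice_point z \<in> interior unit_cube \<or> y - lattice_point z \<notin> unit_cube"
  shows "card {z. y - lattice_point z \<in> (unit_cube :: (real ^ 'n::finite) set)} = 1"
proof -
  have "{z. y - lattice_point z \<in> unit_cube} = {\<chi> i. \<lfloor>y $ i\<rfloor>}"
  proof (intro equalityI subsetI)
    fix z assume "z \<in> {z. y - lattice_point z \<in> unit_cube}"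
    then have "y - lattice_point z \<in> box 0 1"
      using assms[of z] by (auto simp: interior_cbox)
    then have "real_of_int (z $ i) < y $ i" "y $ i < real_of_int (z $ i) + 1" for i
      by (auto simp: mem_box_cart algebra_simps)
    then have "\<lfloor>y $ i\<rfloor> = z $ i" for i
      by (intro floor_unique) (auto intro: less_imp_le)
    then show "z \<in> {\<chi> i. \<lfloor>y $ i\<rfloor>}"
      by (simp add: vec_eq_iff)
  next
    fix z assume "z \<in> {\<chi> i. \<lfloor>y $ i\<rfloor>}"
    then have "z $ i = \<lfloor>y $ i\<rfloor>" for i by simp
    then show "z \<in> {z. y - lattice_point z \<in> unit_cube}"
      using real_of_int_floor_add_one_ge by (auto simp: mem_box_cart algebra_simps)
  qed
  then show ?thesis by simp
qed

section \<open>The signed count is constant\<close>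

theorem theorem3p7:
  fixes M :: "real ^ ('r::finite + 'k::finite) ^ ('r + 'k)"
    and w :: "real ^ ('r + 'k)"
  assumes "invertible M"
    and "sufficiently_generic M w"
  shows "(\<forall>p. finite {t \<in> pos_tiles M \<union> neg_tiles M. p \<in> tile w M t}) \<and>
         (\<forall>p. real_of_int (signed_count w M p) = (-1) ^ CARD('k) * sgn (det M))"
proof (intro conjI allI)
  fix p
  have "{t \<in> pos_tiles M \<union> neg_tiles M. p \<in> tile w M t} \<subseteq>
      prod.swap ` (SIGMA \<sigma>:UNIV. {z. p \<in> tile w M (z, \<sigma>)})"
    by (auto simp: image_iff)
  then show "finite {t \<in> pos_tiles M \<union> neg_tiles M. p \<in> tile w M t}"
    by (rule finite_subset) (intro finite_imageI finite_SigmaI finite_translates_containing assms(1) finite)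
next
  fix p
  obtain M' where inv: "M ** M' = mat 1" "M' ** M = mat 1"
    using assms(1) invertible_def by blast
  have dets: "det M' * det M = 1"
    using inv(2) by (metis det_I det_mul)
  then have detM: "det M \<noteq> 0" by auto
  with dets have detM': "det M' = 1 / det M"
    by (simp add: eq_divide_eq)
  have genM: "w \<notin> span ((\<lambda>i. column i M) ` J)" if "card J = CARD('r + 'k) - 1" for J
    using assms(2) that unfolding sufficiently_generic_def by auto
  have gen: "w \<notin> span ((\<lambda>i. column i (fragment \<sigma> M)) ` J)"
    if "card J = CARD('r + 'k) - 1" "card \<sigma> = CARD('r)" for J \<sigma>
    using assms(2) that unfolding sufficiently_generic_def by auto
  let ?S = "{\<sigma> :: ('r + 'k) set. card \<sigma> = CARD('r) \<and> det (fragment \<sigma> M) \<noteq> 0}"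
  define N where "N \<sigma> = M' ** fragment \<sigma> M" for \<sigma>
  define K where "K \<sigma> = (*v) (N \<sigma>) ` unit_cube" for \<sigma>
  define Z where "Z \<sigma> = {z. p \<in> tile w M (z, \<sigma>)}" for \<sigma>
  define v where "v = M' *v w"
  have detN: "det (N \<sigma>) = det (fragment \<sigma> M) / det M" for \<sigma>
    by (simp add: N_def det_mul detM')
  have compactK: "compact (K \<sigma>)" for \<sigma>
    unfolding K_def by (intro compact_continuous_image continuous_intros compact_cbox)
  have Z_iff: "z \<in> Z \<sigma> \<longleftrightarrow> (\<forall>\<^sub>F \<epsilon> in at_right 0. M' *v p - lattice_point z + \<epsilon> *\<^sub>R v \<in> K \<sigma>)" for z \<sigma>
    unfolding Z_def K_def N_def v_def mem_Collect_eq by (rule tile_iff[OF inv])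

  \<comment> \<open>Push \<open>p\<close> in the direction of \<open>w\<close>, to a point \<open>y\<close> that is off the walls of all tiles with
    nonzero determinant and of all unit cubes; \<open>p\<close> lies in a half-open tile iff \<open>y\<close> lies inside it.\<close>
  have "\<forall>\<^sub>F \<epsilon> in at_right 0. \<forall>z. if z \<in> Z \<sigma>
      then M' *v p + \<epsilon> *\<^sub>R v - lattice_point z \<in> interior (K \<sigma>)
      else M' *v p + \<epsilon> *\<^sub>R v - lattice_point z \<notin> K \<sigma>" if \<sigma>: "\<sigma> \<in> ?S" for \<sigma>
    unfolding Z_iff
  proof (rule eventually_all_translates_inside_or_outside)
    show "bounded (K \<sigma>)" using compactK by (rule compact_imp_bounded)
    have "det (fragment \<sigma> M) \<noteq> 0" using \<sigma> by simp
    then obtain F' where "fragment \<sigma> M ** F' = mat 1"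
      using invertible_det_nz invertible_def by metis
    then have b: "fragment \<sigma> M *v (F' *v w) = w"
      by (simp add: matrix_vector_mul_assoc)
    then have "(F' *v w) $ i \<noteq> 0" for i
      using gen \<sigma> by (intro generic_coordinates_nonzero[of "fragment \<sigma> M"]) auto
    moreover have "v = N \<sigma> *v (F' *v w)"
      by (simp add: v_def N_def b flip: matrix_vector_mul_assoc)
    moreover have "det (N \<sigma>) \<noteq> 0" using \<sigma> detM by (simp add: detN)
    ultimately show "(\<forall>\<^sub>F \<epsilon> in at_right 0. M' *v p - lattice_point z + \<epsilon> *\<^sub>R v \<in> interior (K \<sigma>)) \<or>
        (\<forall>\<^sub>F \<epsilon> in at_right 0. M' *v p - lattice_point z + \<epsilon> *\<^sub>R v \<notin> K \<sigma>)" for z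
      unfolding K_def using eventually_inside_or_outside[of "N \<sigma>" "F' *v w"] by metis
  qed
  then have ev1: "\<forall>\<^sub>F \<epsilon> in at_right 0. \<forall>\<sigma>\<in>?S. \<forall>z. if z \<in> Z \<sigma>
      then M' *v p + \<epsilon> *\<^sub>R v - lattice_point z \<in> interior (K \<sigma>)
      else M' *v p + \<epsilon> *\<^sub>R v - lattice_point z \<notin> K \<sigma>"
    by (intro eventually_ball_finite) auto
  have "M *v v = w"
    by (simp add: v_def matrix_vector_mul_assoc inv)
  then have "v $ i \<noteq> 0" for i
    using genM by (intro generic_coordinates_nonzero[of M]) auto
  then have cube: "(\<forall>\<^sub>F \<epsilon> in at_right 0. M' *v p - lattice_point z + \<epsilon> *\<^sub>R v \<in> interior unit_cube) \<or>
      (\<forall>\<^sub>F \<epsilon> in at_right 0. M' *v p - lattice_point z + \<epsilon> *\<^sub>R v \<notin> unit_cube)" for z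
    using eventually_inside_or_outside[of "mat 1" v "M' *v p - lattice_point z"] by simp
  have ev2: "\<forall>\<^sub>F \<epsilon> in at_right 0. \<forall>z. M' *v p + \<epsilon> *\<^sub>R v - lattice_point z \<in> interior unit_cube \<or>
      M' *v p + \<epsilon> *\<^sub>R v - lattice_point z \<notin> unit_cube"
    by (rule eventually_mono[OF eventually_all_translates_inside_or_outside[OF bounded_cbox cube]]) meson
  obtain \<epsilon> where \<epsilon>: "\<forall>\<sigma>\<in>?S. \<forall>z. if z \<in> Z \<sigma>
      then M' *v p + \<epsilon> *\<^sub>R v - lattice_point z \<in> interior (K \<sigma>)
      else M' *v p + \<epsilon> *\<^sub>R v - lattice_point z \<notin> K \<sigma>"
    "\<forall>z. M' *v p + \<epsilon> *\<^sub>R v - lattice_point z \<in> interior unit_cube \<or>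
      M' *v p + \<epsilon> *\<^sub>R v - lattice_point z \<notin> unit_cube"
    using eventually_happens'[OF trivial_limit_at_right_real eventually_conj[OF ev1 ev2]] by blast
  define y where "y = M' *v p + \<epsilon> *\<^sub>R v"
  have inside: "y - lattice_point z \<in> interior (K \<sigma>) \<or> y - lattice_point z \<notin> K \<sigma>" if "\<sigma> \<in> ?S" for \<sigma> z
    using \<epsilon>(1) that unfolding y_def by meson
  have Z_eq: "Z \<sigma> = {z. y - lattice_point z \<in> K \<sigma>}" if "\<sigma> \<in> ?S" for \<sigma>
    using \<epsilon>(1) that interior_subset unfolding y_def by (smt (verit, best) Collect_cong Collect_mem_eq subsetD)

  \<comment> \<open>A ball around \<open>y\<close> none of whose lattice translates meets a wall.\<close>
  have "\<forall>\<^sub>F \<eta> in at_right 0. \<forall>\<sigma>\<in>?S. \<forall>z.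
      ball (y - lattice_point z) \<eta> \<subseteq> K \<sigma> \<or> ball (y - lattice_point z) \<eta> \<inter> K \<sigma> = {}"
    by (intro eventually_ball_finite ballI eventually_balls_decided compactK inside) auto
  moreover have "\<forall>\<^sub>F \<eta> in at_right 0. \<forall>z.
      ball (y - lattice_point z) \<eta> \<subseteq> unit_cube \<or> ball (y - lattice_point z) \<eta> \<inter> unit_cube = {}"
    using \<epsilon>(2) by (intro eventually_balls_decided compact_cbox) (simp add: y_def)
  moreover have "\<forall>\<^sub>F \<eta> in at_right (0::real). 0 < \<eta> \<and> \<eta> \<le> 1/2"
    using eventually_small_at_right[of "1/2"] by (rule eventually_mono) auto
  ultimately have "\<forall>\<^sub>F \<eta> in at_right 0. (\<forall>\<sigma>\<in>?S. \<forall>z.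
      ball (y - lattice_point z) \<eta> \<subseteq> K \<sigma> \<or> ball (y - lattice_point z) \<eta> \<inter> K \<sigma> = {}) \<and>
      (\<forall>z. ball (y - lattice_point z) \<eta> \<subseteq> unit_cube \<or> ball (y - lattice_point z) \<eta> \<inter> unit_cube = {}) \<and>
      0 < \<eta> \<and> \<eta> \<le> 1/2"
    by eventually_elim simp
  then obtain \<eta> where \<eta>: "\<forall>\<sigma>\<in>?S. \<forall>z.
      ball (y - lattice_point z) \<eta> \<subseteq> K \<sigma> \<or> ball (y - lattice_point z) \<eta> \<inter> K \<sigma> = {}"
      "\<forall>z. ball (y - lattice_point z) \<eta> \<subseteq> unit_cube \<or> ball (y - lattice_point z) \<eta> \<inter> unit_cube = {}"
      "0 < \<eta>" "\<eta> \<le> 1/2"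
    using eventually_happens'[OF trivial_limit_at_right_real] by blast

  \<comment> \<open>A periodic bump function supported on the lattice translates of this ball.\<close>
  define \<delta> where "\<delta> = 2 * sin (pi * (\<eta> / CARD('r + 'k)))"
  define \<phi> where "\<phi> \<zeta> = max 0 (\<delta> - norm (\<zeta> - torus y))" for \<zeta>
  define \<psi> where "\<psi> x = \<phi> (torus x)" for x
  have \<phi>: "continuous_on UNIV \<phi>"
    unfolding \<phi>_def by (intro continuous_intros)
  then have \<psi>: "continuous_on UNIV \<psi>"
    unfolding \<psi>_def by (rule continuous_on_compose2) (auto intro: continuous_intros)
  have periodic: "\<psi> (x - lattice_point z) = \<psi> x" for x z
    by (simp add: \<psi>_def torus_minus_lattice_point)
  have supp: "\<exists>z. x \<in> ball (y - lattice_point z) \<eta>" if "\<psi> x \<noteq> 0" for x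
  proof -
    have "norm (torus x - torus y) < \<delta>"
      using that by (simp add: \<psi>_def \<phi>_def max_def split: if_splits)
    then show ?thesis
      using near_lattice_if_torus_close[OF \<eta>(3,4)] unfolding \<delta>_def by metis
  qed
  have "\<delta> > 0"
  proof -
    define c where "c = real CARD('r + 'k)"
    have c: "c \<ge> 1"
      unfolding c_def using zero_less_card_finite[where 'a = "'r + 'k"] by linarith
    then have "\<eta> / c < 1" "0 < \<eta> / c"
      using \<eta>(3,4) by (simp_all add: divide_less_eq)
    then have "0 < pi * (\<eta> / c)" "pi * (\<eta> / c) < pi"
      using mult_strict_left_mono[of "\<eta> / c" 1 pi] by (auto intro: mult_pos_pos simp del: times_divide_eq_right)
    then show ?thesis
      unfolding \<delta>_def c_def[symmetric] using sin_gt_zero by simp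
  qed
  define J where "J = (LINT x:ball y \<eta>|lborel. \<psi> x)"
  have J: "J > 0"
    unfolding J_def using \<open>\<delta> > 0\<close> \<eta>(3)
    by (intro set_integral_ball_pos \<psi>) (auto simp: \<psi>_def \<phi>_def)

  \<comment> \<open>Every integral in the vanishing defect of the bump is a count times its mass \<open>J\<close>.\<close>
  have frag: "det (fragment \<sigma> M) * (LINT x:unit_cube|lborel. \<psi> (M' *v (fragment \<sigma> M *v x))) =
      \<bar>det M\<bar> * J * (sgn (det (fragment \<sigma> M)) * card (Z \<sigma>))" if \<sigma>: "card \<sigma> = CARD('r)" for \<sigma>
  proof (cases "det (fragment \<sigma> M) = 0")
    case False
    then have S: "\<sigma> \<in> ?S" using \<sigma> by simp
    have dec: "ball (y - lattice_point z) \<eta> \<subseteq> (*v) (N \<sigma>) ` unit_cube \<or>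
        ball (y - lattice_point z) \<eta> \<inter> (*v) (N \<sigma>) ` unit_cube = {}" for z
      using \<eta>(1) S unfolding K_def by blast
    define I where "I = (LINT x:unit_cube|lborel. \<psi> (N \<sigma> *v x))"
    have "\<bar>det (N \<sigma>)\<bar> * I = card (Z \<sigma>) * J"
      unfolding Z_eq[OF S] K_def J_def I_def
      using False detM
      by (intro integral_matrix_periodic_bump[OF _ \<psi> periodic supp \<eta>(3,4) dec]) (simp add: detN)
    then have "\<bar>det (fragment \<sigma> M)\<bar> * I = \<bar>det M\<bar> * (card (Z \<sigma>) * J)"
      using detM by (simp add: detN field_simps)
    then have "sgn (det (fragment \<sigma> M)) * \<bar>det (fragment \<sigma> M)\<bar> * I =
        sgn (det (fragment \<sigma> M)) * (\<bar>det M\<bar> * (card (Z \<sigma>) * J))"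
      by (simp only: mult.assoc)
    then have "det (fragment \<sigma> M) * I = \<bar>det M\<bar> * J * (sgn (det (fragment \<sigma> M)) * card (Z \<sigma>))"
      unfolding sgn_mult_abs by (simp only: mult_ac)
    then show ?thesis
      by (simp add: I_def N_def matrix_vector_mul_assoc)
  qed simp
  have "(LINT x:unit_cube|lborel. \<psi> x) = J"
  proof -
    have "\<bar>det (mat 1 :: real ^ ('r + 'k) ^ ('r + 'k))\<bar> * (LINT x:unit_cube|lborel. \<psi> (mat 1 *v x)) =
        card {z. y - lattice_point z \<in> (*v) (mat 1) ` unit_cube} * J"
      unfolding J_def using \<eta>(2) by (intro integral_matrix_periodic_bump[OF _ \<psi> periodic supp \<eta>(3,4)]) auto
    then show ?thesis
      using card_integer_translates_in_unit_cube[of y] \<epsilon>(2) by (simp add: y_def)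
  qed
  moreover have "fragment_defect M M' \<psi> = 0"
    unfolding \<psi>_def by (rule fragment_defect_torus[OF inv(2) \<phi>])
  ultimately have "(\<Sum>\<sigma> | card \<sigma> = CARD('r). \<bar>det M\<bar> * J * (sgn (det (fragment \<sigma> M)) * card (Z \<sigma>))) =
      (-1) ^ CARD('k) * det M * J"
    by (simp add: fragment_defect_def frag)
  then have "\<bar>det M\<bar> * J * real_of_int (signed_count w M p) = (-1) ^ CARD('k) * det M * J"
    by (simp add: signed_count_eq_sum[OF assms(1)] Z_def sum_distrib_left)
  also have "\<dots> = \<bar>det M\<bar> * J * ((-1) ^ CARD('k) * sgn (det M))"
    by (simp add: sgn_real_def)
  finally show "real_of_int (signed_count w M p) = (-1) ^ CARD('k) * sgn (det M)"
    using J detM by simp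
qed

end
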